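(* Let $F$ be a CDF on $\mathbb R$ with $\int|w|\,\mathrm dF(w)<\infty$ and with density $f:\mathbb R\to\mathbb R_+$. Suppose that, for some $\omega\in\mathbb R$, $f$ is continuously differentiable and strictly positive on $(-\infty,\omega)$, and that $\log f$ is strictly convex on $(-\infty,\omega)$. Then there exist an investment menu $B=\{\mathbf 0,b\}$, a binary (i.e. $|X|=2$) MLR-ordered experiment $\alpha$, and increasing, Lipschitz continuous, concave utility functions $u,v$ satisfying (ZAZI) such that $u$ is more risk averse than $v$ and $$M(u)>M(v),$$ where $M$ is willingness to pay for information in the environment $(F,B,\alpha)$.
   Context: $F$-integrable means measurable with $\int|\cdot|\,\mathrm dF<\infty$. $U$ is the set of strictly increasing functions $u:\mathbb R\to\mathbb R$ that are $F$-integrable, absolutely continuous on every bounded interval, and satisfy $\limsup_{m\to\infty}u(m)/m<\infty$; utility functions are elements of $U$. For $u,v\in U$, $v$ is more risk averse than $u$ if $v=\phi\circ u$ for some increasing and (weakly) concave $\phi:\mathbb R\to\mathbb R$ ("increasing" is in the strict sense). An asset is an $F$-integrable map $b:\mathbb R\to\mathbb R$; $\mathbf 0$ is the zero asset (status quo). A menu $B$ is a set of assets containing $\mathbf 0$ and compact in the $L^1(F)$ metric. An investment is a nondecreasing asset. $B$ is an investment menu if each $b\in B$ is an investment and there exist $w^*\in\mathbb R\cup\{\pm\infty\}$ and a complete ordering $\succeq$ of $B$ such that, for all $b,b'\in B$ with $b'\succeq b$: $b'(w)\le b(w)$ for all real $w\le w^*$ and $b'(w)\ge b(w)$ for all real $w\ge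 w^*$. An experiment is $\alpha=(X,(h_w)_{w\in\mathbb R})$ with $X\subset\mathbb R$ finite, each $h_w$ a probability mass function on $X$, $w\mapsto h_w(x)$ measurable for each $x$, and $h(x)=\int h_w(x)\,\mathrm dF(w)>0$ for every $x\in X$. It is MLR-ordered if $h_w(x)h_{w'}(x')\ge h_w(x')h_{w'}(x)$ whenever $w\le w'$ and $x\le x'$. The posterior after $x$ has density $f_x(w)=h_w(x)f(w)/h(x)$ and CDF $F_x$. A strategy is $\beta=(\beta_x)_{x\in X}\in B^X$. For $\mu\ge0$, $G^\mu_\beta(m)=\sum_{x\in X}h(x)\int\mathbf 1_{\{w+\beta_x(w)-\mu\le m\}}\,\mathrm dF_x(w)$. For each $u\in U$, the integrals $\int u\,\mathrm dG^\mu_\beta$ exist in $\mathbb R\cup\{-\infty\}$ and the maximum over $\beta\in B^X$ is attained; $M(u)\in\mathbb R_+$ is the unique number such that $\max_{\beta}\int u\,\mathrm dG^\mu_\beta<\int u\,\mathrm dF$ for all $\mu>M(u)$ and $\max_{\beta}\int u\,\mathrm dG^\mu_\beta>\int u\,\mathrm dF$ for all $0\le\mu<M(u)$. (ZAZI) for $u$: $\mathbf 0\in\arg\max_{b\in B}\int u(w+b(w))\,\mathrm dF(w)$. *)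

theory Defs
  imports "HOL-Probability.Probability"
begin

definition is_cdf :: "(real \<Rightarrow> real) \<Rightarrow> bool" where
  "is_cdf F \<longleftrightarrow> mono F \<and> (\<forall>x. continuous (at_right x) F) \<and>
     (F \<longlongrightarrow> 0) at_bot \<and> (F \<longlongrightarrow> 1) at_top"

text \<open>A CDF is a plain function \<open>F\<close>; integration against \<open>dF\<close> is integration with respect to its
  Lebesgue-Stieltjes measure \<^term>\<open>interval_measure F\<close>, a measure on the Borel sets.\<close>

definition has_density :: "(real \<Rightarrow> real) \<Rightarrow> (real \<Rightarrow> real) \<Rightarrow> bool" where
  "has_density F f \<longleftrightarrow> f \<in> borel_measurable borel \<and> (\<forall>w. 0 \<le> f w) \<and>
     interval_measure F = density lborel (\<lambda>w. ennreal (f w))"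

abbreviation F_integrable :: "(real \<Rightarrow> real) \<Rightarrow> (real \<Rightarrow> real) \<Rightarrow> bool" where
  "F_integrable F g \<equiv> integrable (interval_measure F) g"

text \<open>Integral with values in the extended reals. It is only meaningful when at least one of the two
  terms is finite; below the first one always is, by the growth condition on utility functions.\<close>

definition ext_integral :: "real measure \<Rightarrow> (real \<Rightarrow> real) \<Rightarrow> ereal" where
  "ext_integral M g =
     enn2ereal (\<integral>\<^sup>+ x. ennreal (g x) \<partial>M) - enn2ereal (\<integral>\<^sup>+ x. ennreal (- g x) \<partial>M)"

definition strictly_convex_on :: "real set \<Rightarrow> (real \<Rightarrow> real) \<Rightarrow> bool" where
  "strictly_convex_on S g \<longleftrightarrow> convex S \<and>
     (\<forall>x\<in>S. \<forall>y\<in>S. \<forall>t. x \<noteq> y \<and> 0 < t \<and> t < 1 \<longrightarrow>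
        g ((1 - t) * x + t * y) < (1 - t) * g x + t * g y)"

definition absolutely_continuous_on :: "real set \<Rightarrow> (real \<Rightarrow> real) \<Rightarrow> bool" where
  "absolutely_continuous_on S g \<longleftrightarrow>
     (\<forall>\<epsilon>>0. \<exists>\<delta>>0. \<forall>P. finite P \<and> (\<forall>(s, t)\<in>P. s < t \<and> {s..t} \<subseteq> S) \<and>
        disjoint_family_on (\<lambda>(s, t). {s<..<t}) P \<and> (\<Sum>(s, t)\<in>P. t - s) < \<delta> \<longrightarrow>
        (\<Sum>(s, t)\<in>P. \<bar>g t - g s\<bar>) < \<epsilon>)"

definition utilities :: "(real \<Rightarrow> real) \<Rightarrow> (real \<Rightarrow> real) set" where
  "utilities F = {u. strict_mono u \<and> F_integrable F u \<and>
     (\<forall>a b. absolutely_continuous_on {a..b} u) \<and>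
     Limsup at_top (\<lambda>m. ereal (u m / m)) < \<infinity>}"

definition more_risk_averse :: "(real \<Rightarrow> real) \<Rightarrow> (real \<Rightarrow> real) \<Rightarrow> bool" where
  "more_risk_averse v u \<longleftrightarrow> (\<exists>\<phi>. strict_mono \<phi> \<and> concave_on UNIV \<phi> \<and> v = \<phi> \<circ> u)"

text \<open>The \<open>L\<^sup>1(F)\<close> topology lives on functions, not on classes of functions agreeing
  almost everywhere, so the distance is only a pseudometric.\<close>

definition L1_ball :: "(real \<Rightarrow> real) \<Rightarrow> (real \<Rightarrow> real) \<Rightarrow> real \<Rightarrow> (real \<Rightarrow> real) set" where
  "L1_ball F b e = {c. F_integrable F c \<and> (\<integral>w. \<bar>b w - c w\<bar> \<partial>interval_measure F) < e}"

definition L1_topology :: "(real \<Rightarrow> real) \<Rightarrow> (real \<Rightarrow> real) topology" where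
  "L1_topology F = topology_generated_by {L1_ball F b e | b e. F_integrable F b \<and> 0 < e}"

definition is_menu :: "(real \<Rightarrow> real) \<Rightarrow> (real \<Rightarrow> real) set \<Rightarrow> bool" where
  "is_menu F B \<longleftrightarrow> (\<forall>b\<in>B. F_integrable F b) \<and> (\<lambda>_. 0) \<in> B \<and> compactin (L1_topology F) B"

text \<open>\<open>(b, b') \<in> R\<close> stands for \<open>b' \<succeq> b\<close>. Antisymmetry of \<open>R\<close> is no extra requirement: if each of two
  assets is ranked above the other, the inequalities make them equal everywhere.\<close>

definition is_investment_menu :: "(real \<Rightarrow> real) \<Rightarrow> (real \<Rightarrow> real) set \<Rightarrow> bool" where
  "is_investment_menu F B \<longleftrightarrow> is_menu F B \<and> (\<forall>b\<in>B. mono b) \<and>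
     (\<exists>(ws :: ereal) R. linear_order_on B R \<and>
        (\<forall>b\<in>B. \<forall>b'\<in>B. (b, b') \<in> R \<longrightarrow>
           (\<forall>w. ereal w \<le> ws \<longrightarrow> b' w \<le> b w) \<and> (\<forall>w. ws \<le> ereal w \<longrightarrow> b w \<le> b' w)))"

text \<open>An experiment is a finite signal set \<open>X\<close> with a kernel \<open>h\<close>, where \<^term>\<open>pmf (h w) x\<close> is the
  probability of signal \<open>x\<close> in state \<open>w\<close>.\<close>

definition signal_prob :: "(real \<Rightarrow> real) \<Rightarrow> (real \<Rightarrow> real pmf) \<Rightarrow> real \<Rightarrow> real" where
  "signal_prob F h x = (\<integral>w. pmf (h w) x \<partial>interval_measure F)"

definition is_experiment :: "(real \<Rightarrow> real) \<Rightarrow> real set \<Rightarrow> (real \<Rightarrow> real pmf) \<Rightarrow> bool" where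
  "is_experiment F X h \<longleftrightarrow> finite X \<and> (\<forall>w. set_pmf (h w) \<subseteq> X) \<and>
     (\<forall>x\<in>X. (\<lambda>w. pmf (h w) x) \<in> borel_measurable borel) \<and> (\<forall>x\<in>X. 0 < signal_prob F h x)"

definition MLR_ordered :: "real set \<Rightarrow> (real \<Rightarrow> real pmf) \<Rightarrow> bool" where
  "MLR_ordered X h \<longleftrightarrow> (\<forall>w w'. \<forall>x\<in>X. \<forall>x'\<in>X. w \<le> w' \<and> x \<le> x' \<longrightarrow>
     pmf (h w) x * pmf (h w') x' \<ge> pmf (h w) x' * pmf (h w') x)"

definition posterior_density ::
  "(real \<Rightarrow> real) \<Rightarrow> (real \<Rightarrow> real) \<Rightarrow> (real \<Rightarrow> real pmf) \<Rightarrow> real \<Rightarrow> real \<Rightarrow> real" where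
  "posterior_density F f h x w = pmf (h w) x * f w / signal_prob F h x"

definition posterior_cdf ::
  "(real \<Rightarrow> real) \<Rightarrow> (real \<Rightarrow> real) \<Rightarrow> (real \<Rightarrow> real pmf) \<Rightarrow> real \<Rightarrow> real \<Rightarrow> real" where
  "posterior_cdf F f h x m = (LINT w:{..m}|lborel. posterior_density F f h x w)"

definition strategies :: "(real \<Rightarrow> real) set \<Rightarrow> real set \<Rightarrow> (real \<Rightarrow> real \<Rightarrow> real) set" where
  "strategies B X = X \<rightarrow>\<^sub>E B"

definition outcome_cdf ::
  "(real \<Rightarrow> real) \<Rightarrow> (real \<Rightarrow> real) \<Rightarrow> real set \<Rightarrow> (real \<Rightarrow> real pmf) \<Rightarrow> (real \<Rightarrow> real \<Rightarrow> real) \<Rightarrow>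
   real \<Rightarrow> real \<Rightarrow> real" where
  "outcome_cdf F f X h \<beta> \<mu> m =
     (\<Sum>x\<in>X. signal_prob F h x *
        (\<integral>w. indicator {w. w + \<beta> x w - \<mu> \<le> m} w \<partial>interval_measure (posterior_cdf F f h x)))"

text \<open>The supremum over strategies is attained under the standing assumptions, so it is the maximum.\<close>

definition informed_value ::
  "(real \<Rightarrow> real) \<Rightarrow> (real \<Rightarrow> real) \<Rightarrow> (real \<Rightarrow> real) set \<Rightarrow> real set \<Rightarrow> (real \<Rightarrow> real pmf) \<Rightarrow>
   (real \<Rightarrow> real) \<Rightarrow> real \<Rightarrow> ereal" where
  "informed_value F f B X h u \<mu> =
     (SUP \<beta>\<in>strategies B X. ext_integral (interval_measure (outcome_cdf F f X h \<beta> \<mu>)) u)"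

definition willingness_to_pay ::
  "(real \<Rightarrow> real) \<Rightarrow> (real \<Rightarrow> real) \<Rightarrow> (real \<Rightarrow> real) set \<Rightarrow> real set \<Rightarrow> (real \<Rightarrow> real pmf) \<Rightarrow>
   (real \<Rightarrow> real) \<Rightarrow> real" where
  "willingness_to_pay F f B X h u = (THE M. 0 \<le> M \<and>
     (\<forall>\<mu>>M. informed_value F f B X h u \<mu> < ext_integral (interval_measure F) u) \<and>
     (\<forall>\<mu>. 0 \<le> \<mu> \<and> \<mu> < M \<longrightarrow> ext_integral (interval_measure F) u < informed_value F f B X h u \<mu>))"

definition ZAZI :: "(real \<Rightarrow> real) \<Rightarrow> (real \<Rightarrow> real) set \<Rightarrow> (real \<Rightarrow> real) \<Rightarrow> bool" where
  "ZAZI F B u \<longleftrightarrow>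
     is_arg_max (\<lambda>b. ext_integral (interval_measure F) (\<lambda>w. u (w + b w))) (\<lambda>b. b \<in> B) (\<lambda>_. 0)"

end

theory Submission
  imports Defs
begin

text \<open>The asset pays \<open>2\<close> above a remote threshold \<open>ws\<close> and loses a large \<open>A\<close> below it. The binary signal
  is never high below \<open>ws\<close> and is high with probability \<open>q\<close> above it, so an agent who invests after the
  high signal never suffers the loss, while \<open>A\<close> makes every other strategy (in particular investing
  blindly) unattractive. For the utility \<open>min m k\<close>, buying this information at price \<open>1\<close> changes
  expected utility by \<open>q (H (k + 1) + H k) - H (k + 1)\<close>, up to an error of order \<open>F ws\<close>, where
  \<open>H k = E [min 1 (max 0 (k - w))]\<close>. As \<open>H\<close> is a convolution of \<open>f\<close>, it is strictly log-convex up to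
  \<open>\<omega>\<close>; hence \<open>H (k + 1) / H k\<close> increases with \<open>k\<close> and some \<open>q\<close> makes the change positive at
  \<open>k = \<omega> - 2\<close> and negative at \<open>k = \<omega> - 1\<close>. The more risk averse utility has its kink at \<open>\<omega> - 2\<close>, the
  other one only at \<open>\<omega> - 1\<close>; so the former values the information at more than \<open>1\<close> and the latter at
  less than \<open>1\<close>.\<close>

subsection \<open>Outcome distributions\<close>

lemma real_distribution_interval_measure_is_cdf:
  assumes "is_cdf F"
  shows "real_distribution (interval_measure F)"
  using assms by (intro real_distribution_interval_measure) (auto simp: is_cdf_def mono_def)

text \<open>A real distribution is determined by its cdf. Identifying the Stieltjes measure of a
  posterior or outcome cdf thus reduces to computing the cdf of a concrete measure.\<close>

lemma interval_measure_eqI: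
  assumes "real_distribution N" "cdf N = G"
  shows "interval_measure G = N"
proof (rule cdf_unique)
  interpret real_distribution N by fact
  show "real_distribution (interval_measure G)"
    using cdf_nondecreasing cdf_is_right_cont cdf_lim_at_bot cdf_lim_at_top_prob assms(2)
    by (intro real_distribution_interval_measure) auto
  show "cdf (interval_measure G) = cdf N"
    using cdf_nondecreasing cdf_is_right_cont cdf_lim_at_bot cdf_lim_at_top_prob assms(2)
    by (intro trans[OF cdf_interval_measure]) auto
qed fact

lemma ext_integral_eq_integral:
  assumes "integrable M g"
  shows "ext_integral M g = ereal (\<integral>x. g x \<partial>M)"
proof -
  have "(\<integral>\<^sup>+ x. ennreal (g x) \<partial>M) < top" "(\<integral>\<^sup>+ x. ennreal (- g x) \<partial>M) < top"
    using assms by (simp_all add: real_integrable_def less_top)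
  then obtain a b where "0 \<le> a" "0 \<le> b" "(\<integral>\<^sup>+ x. ennreal (g x) \<partial>M) = ennreal a"
    "(\<integral>\<^sup>+ x. ennreal (- g x) \<partial>M) = ennreal b"
    by (metis ennreal_cases less_irrefl)
  then show ?thesis
    unfolding ext_integral_def real_lebesgue_integral_def[OF assms] by simp
qed

text \<open>The joint law of signal and state has density \<^term>\<open>pmf (h w) x\<close> with respect to counting
  measure times \<open>dF\<close>; the outcome measure is its image.\<close>

definition outcome_measure ::
  "(real \<Rightarrow> real) \<Rightarrow> real set \<Rightarrow> (real \<Rightarrow> real pmf) \<Rightarrow> (real \<Rightarrow> real \<Rightarrow> real) \<Rightarrow> real \<Rightarrow> real measure" where
  "outcome_measure F X h \<beta> \<mu> =
     distr (density (count_space X \<Otimes>\<^sub>M interval_measure F) (\<lambda>z. ennreal (pmf (h (snd z)) (fst z))))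
       borel (\<lambda>z. snd z + \<beta> (fst z) (snd z) - \<mu>)"

lemma nn_integral_outcome_measure:
  assumes "is_cdf F" "is_experiment F X h" "\<And>x. x \<in> X \<Longrightarrow> \<beta> x \<in> borel_measurable borel"
    and [measurable]: "g \<in> borel_measurable borel"
  shows "(\<integral>\<^sup>+ m. g m \<partial>outcome_measure F X h \<beta> \<mu>) =
    (\<Sum>x\<in>X. \<integral>\<^sup>+ w. ennreal (pmf (h w) x) * g (w + \<beta> x w - \<mu>) \<partial>interval_measure F)"
proof -
  interpret P: real_distribution "interval_measure F"
    using assms(1) by (rule real_distribution_interval_measure_is_cdf)
  have X: "finite X" and h[measurable]: "\<And>x. x \<in> X \<Longrightarrow> (\<lambda>w. pmf (h w) x) \<in> borel_measurable borel"
    using assms(2) by (auto simp: is_experiment_def)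
  note assms(3)[measurable]
  \<comment> \<open>The first factor is countable, so joint measurability follows from measurability
    in the state for each fixed signal.\<close>
  have [measurable]: "(\<lambda>z. pmf (h (snd z)) (fst z)) \<in> borel_measurable (count_space X \<Otimes>\<^sub>M interval_measure F)"
    by (rule measurable_pair_measure_countable1) (auto simp: X countable_finite)
  have [measurable]: "(\<lambda>z. snd z + \<beta> (fst z) (snd z) - \<mu>) \<in> borel_measurable (count_space X \<Otimes>\<^sub>M interval_measure F)"
    by (rule measurable_pair_measure_countable1) (auto simp: X countable_finite)
  have "(\<integral>\<^sup>+ m. g m \<partial>outcome_measure F X h \<beta> \<mu>) =
    (\<integral>\<^sup>+ z. ennreal (pmf (h (snd z)) (fst z)) * g (snd z + \<beta> (fst z) (snd z) - \<mu>) \<partial>(count_space X \<Otimes>\<^sub>M interval_measure F))"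
    unfolding outcome_measure_def by (simp add: nn_integral_distr nn_integral_density)
  also have "\<dots> = (\<integral>\<^sup>+ x. \<integral>\<^sup>+ w. ennreal (pmf (h w) x) * g (w + \<beta> x w - \<mu>) \<partial>interval_measure F \<partial>count_space X)"
    by (subst P.nn_integral_fst[symmetric]) auto
  finally show ?thesis
    by (simp add: nn_integral_count_space_finite X)
qed

lemma real_distribution_outcome_measure:
  assumes "is_cdf F" "is_experiment F X h" "\<And>x. x \<in> X \<Longrightarrow> \<beta> x \<in> borel_measurable borel"
  shows "real_distribution (outcome_measure F X h \<beta> \<mu>)"
proof -
  interpret P: real_distribution "interval_measure F"
    using assms(1) by (rule real_distribution_interval_measure_is_cdf)
  have X: "finite X" "\<And>w. set_pmf (h w) \<subseteq> X"
    and h[measurable]: "\<And>x. x \<in> X \<Longrightarrow> (\<lambda>w. pmf (h w) x) \<in> borel_measurable borel"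
    using assms(2) by (auto simp: is_experiment_def)
  have "emeasure (outcome_measure F X h \<beta> \<mu>) UNIV = (\<integral>\<^sup>+ m. 1 \<partial>outcome_measure F X h \<beta> \<mu>)"
    by (simp add: outcome_measure_def)
  also have "\<dots> = (\<integral>\<^sup>+ w. (\<Sum>x\<in>X. ennreal (pmf (h w) x)) \<partial>interval_measure F)"
    using assms by (subst nn_integral_outcome_measure) (auto simp del: sum_ennreal intro!: nn_integral_sum[symmetric])
  also have "\<dots> = 1"
    using X P.emeasure_space_1 by (simp add: sum_ennreal sum_pmf_eq_1)
  finally show ?thesis
    by (intro real_distribution.intro real_distribution_axioms.intro prob_spaceI)
      (auto simp: outcome_measure_def)
qed

lemma has_densityD:
  assumes "has_density F f"
  shows "f \<in> borel_measurable borel" "\<And>w. 0 \<le> f w"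
    "interval_measure F = density lborel (\<lambda>w. ennreal (f w))"
  using assms by (auto simp: has_density_def)

lemma integral_has_density:
  assumes "has_density F f" "g \<in> borel_measurable borel"
  shows "(\<integral>w. g w \<partial>interval_measure F) = (\<integral>w. f w * g w \<partial>lborel)"
    and "integrable (interval_measure F) g \<longleftrightarrow> integrable lborel (\<lambda>w. f w * g w)"
  using has_densityD[OF assms(1)] assms(2) by (simp_all add: integral_real_density integrable_real_density)

text \<open>The normalising constant is the integral of the numerator, so the posterior density has
  total mass one and \<open>posterior_cdf\<close> is the cdf of a genuine distribution.\<close>

lemma interval_measure_posterior_cdf:
  assumes "is_cdf F" "has_density F f" "is_experiment F X h" "x \<in> X"
  shows "interval_measure (posterior_cdf F f h x) =
    density lborel (\<lambda>w. ennreal (posterior_density F f h x w))" (is "_ = ?N")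
proof (rule interval_measure_eqI)
  interpret P: real_distribution "interval_measure F"
    using assms(1) by (rule real_distribution_interval_measure_is_cdf)
  note f[measurable] = has_densityD[OF assms(2)]
  have h[measurable]: "(\<lambda>w. pmf (h w) x) \<in> borel_measurable borel"
    and pos: "0 < signal_prob F h x"
    using assms(3,4) by (auto simp: is_experiment_def)
  have [measurable]: "posterior_density F f h x \<in> borel_measurable borel"
    unfolding posterior_density_def by measurable
  have nn: "0 \<le> posterior_density F f h x w" for w
    unfolding posterior_density_def using pos f by simp
  have "integrable (interval_measure F) (\<lambda>w. pmf (h w) x)"
    by (rule P.integrable_const_bound[where B=1]) (auto simp: pmf_le_1)
  then have int: "integrable lborel (\<lambda>w. f w * pmf (h w) x)"
    by (simp add: integral_has_density(2)[OF assms(2)])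
  have eq: "posterior_density F f h x w = (f w * pmf (h w) x) / signal_prob F h x" for w
    by (simp add: posterior_density_def mult.commute)
  have int': "integrable lborel (posterior_density F f h x)"
    using int unfolding eq by simp
  have "(\<integral>w. posterior_density F f h x w \<partial>lborel) = 1"
    unfolding eq using pos integral_has_density(1)[OF assms(2) h]
    by (simp add: signal_prob_def)
  then have "(\<integral>\<^sup>+ w. posterior_density F f h x w \<partial>lborel) = 1"
    by (subst nn_integral_eq_integral[OF int']) (auto simp: nn)
  then show N: "real_distribution ?N"
    by (intro real_distribution.intro real_distribution_axioms.intro prob_spaceI)
      (auto simp: emeasure_density)
  interpret N: real_distribution ?N by fact
  show "cdf ?N = posterior_cdf F f h x"
  proof
    fix m
    have "cdf ?N m = (\<integral>w. indicator {..m} w \<partial>?N)"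
      by (simp add: cdf_def)
    also have "\<dots> = (\<integral>w. posterior_density F f h x w * indicator {..m} w \<partial>lborel)"
      by (subst integral_real_density) (auto simp: nn)
    finally show "cdf ?N m = posterior_cdf F f h x m"
      by (simp add: posterior_cdf_def set_lebesgue_integral_def mult.commute)
  qed
qed

text \<open>The weight \<open>signal_prob F h x\<close> cancels the denominator of the posterior
  density; what remains is the mass of \<open>{..m}\<close> under the joint law pushed forward to
  outcomes.\<close>

lemma interval_measure_outcome_cdf:
  assumes "is_cdf F" "has_density F f" "is_experiment F X h"
    "\<And>x. x \<in> X \<Longrightarrow> \<beta> x \<in> borel_measurable borel"
  shows "interval_measure (outcome_cdf F f X h \<beta> \<mu>) = outcome_measure F X h \<beta> \<mu>"
proof (rule interval_measure_eqI)
  let ?N = "outcome_measure F X h \<beta> \<mu>"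
  interpret P: real_distribution "interval_measure F"
    using assms(1) by (rule real_distribution_interval_measure_is_cdf)
  show N: "real_distribution ?N"
    using assms by (intro real_distribution_outcome_measure)
  interpret N: real_distribution ?N by fact
  note f[measurable] = has_densityD[OF assms(2)]
  have h[measurable]: "\<And>x. x \<in> X \<Longrightarrow> (\<lambda>w. pmf (h w) x) \<in> borel_measurable borel"
    and pos: "\<And>x. x \<in> X \<Longrightarrow> 0 < signal_prob F h x"
    using assms(3) by (auto simp: is_experiment_def)
  note assms(4)[measurable]
  show "cdf ?N = outcome_cdf F f X h \<beta> \<mu>"
  proof
    fix m
    have meas: "(\<lambda>w. indicator {w. w + \<beta> x w - \<mu> \<le> m} w :: real) \<in> borel_measurable borel" if "x \<in> X" for x
      using that by measurable
    have int: "integrable (interval_measure F) (\<lambda>w. pmf (h w) x * indicator {w. w + \<beta> x w - \<mu> \<le> m} w)"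
      if "x \<in> X" for x
      using that h meas by (intro P.integrable_const_bound[where B=1])
        (auto simp: pmf_le_1 indicator_def)
    have "signal_prob F h x *
        (\<integral>w. indicator {w. w + \<beta> x w - \<mu> \<le> m} w \<partial>interval_measure (posterior_cdf F f h x)) =
      (\<integral>w. pmf (h w) x * indicator {w. w + \<beta> x w - \<mu> \<le> m} w \<partial>interval_measure F)" if x: "x \<in> X" for x
    proof -
      have [measurable]: "posterior_density F f h x \<in> borel_measurable borel"
        unfolding posterior_density_def using x h by measurable
      have nn: "0 \<le> posterior_density F f h x w" for w
        unfolding posterior_density_def using pos[OF x] f by simp
      have "signal_prob F h x *
        (\<integral>w. indicator {w. w + \<beta> x w - \<mu> \<le> m} w \<partial>interval_measure (posterior_cdf F f h x)) =
        (\<integral>w. signal_prob F h x * (posterior_density F f h x w * indicator {w. w + \<beta> x w - \<mu> \<le> m} w) \<partial>lborel)"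
        unfolding interval_measure_posterior_cdf[OF assms(1-3) x]
        using meas[OF x] by (subst integral_real_density) (auto simp: nn)
      also have "\<dots> = (\<integral>w. f w * (pmf (h w) x * indicator {w. w + \<beta> x w - \<mu> \<le> m} w) \<partial>lborel)"
        using pos[OF x] by (intro Bochner_Integration.integral_cong) (auto simp: posterior_density_def)
      finally show ?thesis
        using x h meas by (simp add: integral_has_density[OF assms(2)])
    qed
    \<comment> \<open>The identity is proved in \<open>ennreal\<close>, where the integration
      formula for the outcome measure lives; nonnegativity of both sides brings it back to the
      reals.\<close>
    then have "ennreal (outcome_cdf F f X h \<beta> \<mu> m) =
      ennreal (\<Sum>x\<in>X. \<integral>w. pmf (h w) x * indicator {w. w + \<beta> x w - \<mu> \<le> m} w \<partial>interval_measure F)"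
      by (simp add: outcome_cdf_def)
    also have "\<dots> = (\<Sum>x\<in>X. ennreal (\<integral>w. pmf (h w) x * indicator {w. w + \<beta> x w - \<mu> \<le> m} w \<partial>interval_measure F))"
      by (intro sum_ennreal[symmetric] integral_nonneg) auto
    also have "\<dots> = (\<Sum>x\<in>X. \<integral>\<^sup>+ w. ennreal (pmf (h w) x * indicator {w. w + \<beta> x w - \<mu> \<le> m} w) \<partial>interval_measure F)"
      using int by (intro sum.cong nn_integral_eq_integral[symmetric]) auto
    also have "\<dots> = (\<integral>\<^sup>+ y. indicator {..m} y \<partial>?N)"
      using assms by (subst nn_integral_outcome_measure)
        (auto intro!: sum.cong nn_integral_cong simp: indicator_def)
    also have "\<dots> = ennreal (cdf ?N m)"
      by (simp add: cdf_def N.emeasure_eq_measure)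
    finally have "ennreal (outcome_cdf F f X h \<beta> \<mu> m) = ennreal (cdf ?N m)" .
    moreover have "0 \<le> outcome_cdf F f X h \<beta> \<mu> m"
      unfolding outcome_cdf_def using pos
      by (intro sum_nonneg mult_nonneg_nonneg integral_nonneg) (auto intro: less_imp_le)
    ultimately show "cdf ?N m = outcome_cdf F f X h \<beta> \<mu> m"
      by (simp add: N.cdf_nonneg)
  qed
qed

text \<open>The integration formula for \<open>outcome_measure\<close> covers nonnegative
  integrands, so the positive and negative parts of \<open>g\<close> are computed separately and
  recombined by linearity.\<close>

lemma ext_integral_outcome_cdf:
  assumes "is_cdf F" "has_density F f" "is_experiment F X h"
    "\<And>x. x \<in> X \<Longrightarrow> \<beta> x \<in> borel_measurable borel"
    and g: "g \<in> borel_measurable borel"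
    and int: "\<And>x. x \<in> X \<Longrightarrow> F_integrable F (\<lambda>w. pmf (h w) x * g (w + \<beta> x w - \<mu>))"
  shows "ext_integral (interval_measure (outcome_cdf F f X h \<beta> \<mu>)) g =
    ereal (\<Sum>x\<in>X. \<integral>w. pmf (h w) x * g (w + \<beta> x w - \<mu>) \<partial>interval_measure F)"
proof -
  \<comment> \<open>The sign \<open>s\<close> serves both parts at once: it is instantiated with 1
    and -1.\<close>
  have *: "(\<integral>\<^sup>+ m. ennreal (s * g m) \<partial>outcome_measure F X h \<beta> \<mu>) =
    ennreal (\<Sum>x\<in>X. \<integral>w. max 0 (s * (pmf (h w) x * g (w + \<beta> x w - \<mu>))) \<partial>interval_measure F)" for s
  proof -
    have "(\<integral>\<^sup>+ m. ennreal (s * g m) \<partial>outcome_measure F X h \<beta> \<mu>) =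
      (\<Sum>x\<in>X. \<integral>\<^sup>+ w. ennreal (max 0 (s * (pmf (h w) x * g (w + \<beta> x w - \<mu>)))) \<partial>interval_measure F)"
      using assms by (subst nn_integral_outcome_measure)
        (auto intro!: sum.cong nn_integral_cong simp: ennreal_mult'[symmetric] ennreal_max_0 ac_simps)
    also have "\<dots> = (\<Sum>x\<in>X. ennreal (\<integral>w. max 0 (s * (pmf (h w) x * g (w + \<beta> x w - \<mu>))) \<partial>interval_measure F))"
      using int by (intro sum.cong nn_integral_eq_integral) auto
    finally show ?thesis
      by (simp add: sum_ennreal)
  qed
  have "ext_integral (outcome_measure F X h \<beta> \<mu>) g =
    ereal ((\<Sum>x\<in>X. \<integral>w. max 0 (pmf (h w) x * g (w + \<beta> x w - \<mu>)) \<partial>interval_measure F) -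
      (\<Sum>x\<in>X. \<integral>w. max 0 (- (pmf (h w) x * g (w + \<beta> x w - \<mu>))) \<partial>interval_measure F))"
    unfolding ext_integral_def using *[of 1] *[of "-1"] by (simp add: sum_nonneg)
  also have "\<dots> = ereal (\<Sum>x\<in>X. \<integral>w. max 0 (pmf (h w) x * g (w + \<beta> x w - \<mu>)) -
      max 0 (- (pmf (h w) x * g (w + \<beta> x w - \<mu>))) \<partial>interval_measure F)"
    using int by (subst sum_subtractf[symmetric]) (auto intro!: sum.cong simp: Bochner_Integration.integral_diff)
  also have "\<dots> = ereal (\<Sum>x\<in>X. \<integral>w. pmf (h w) x * g (w + \<beta> x w - \<mu>) \<partial>interval_measure F)"
    by (intro arg_cong[where f=ereal] sum.cong Bochner_Integration.integral_cong) auto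
  finally show ?thesis
    using assms by (simp add: interval_measure_outcome_cdf)
qed

subsection \<open>Utilities with slopes bounded above and away from zero\<close>

text \<open>The upper bound yields Lipschitz continuity, the lower one strict monotonicity at a
  guaranteed rate. Both survive averaging and finite maxima, so they pass from a utility to the
  value of information as a function of its price.\<close>

definition slopes_within :: "real \<Rightarrow> real \<Rightarrow> (real \<Rightarrow> real) \<Rightarrow> bool" where
  "slopes_within \<gamma> L g \<longleftrightarrow> 0 < \<gamma> \<and>
     (\<forall>x y. x \<le> y \<longrightarrow> \<gamma> * (y - x) \<le> g y - g x \<and> g y - g x \<le> L * (y - x))"

lemma slopes_withinD:
  assumes "slopes_within \<gamma> L g"
  shows "0 < \<gamma>" "\<gamma> \<le> L"
    "\<And>x y. x \<le> y \<Longrightarrow> \<gamma> * (y - x) \<le> g y - g x"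
    "\<And>x y. x \<le> y \<Longrightarrow> g y - g x \<le> L * (y - x)"
proof -
  show *: "0 < \<gamma>" "\<And>x y. x \<le> y \<Longrightarrow> \<gamma> * (y - x) \<le> g y - g x"
    "\<And>x y. x \<le> y \<Longrightarrow> g y - g x \<le> L * (y - x)"
    using assms by (auto simp: slopes_within_def)
  show "\<gamma> \<le> L"
    using *(2,3)[of 0 1] by simp
qed

lemma slopes_within_abs_le:
  assumes "slopes_within \<gamma> L g"
  shows "\<bar>g y - g x\<bar> \<le> L * \<bar>y - x\<bar>"
proof -
  have "\<bar>g y - g x\<bar> \<le> L * \<bar>y - x\<bar>" if "x \<le> y" for x y
  proof -
    have "0 \<le> \<gamma> * (y - x)"
      using that slopes_withinD(1)[OF assms] by simp
    then show ?thesis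
      using slopes_withinD(3,4)[OF assms that] that by simp
  qed
  then show ?thesis
    by (metis abs_minus_commute linear)
qed

lemma slopes_within_strict_mono:
  assumes "slopes_within \<gamma> L g"
  shows "strict_mono g"
proof (rule strict_monoI)
  fix x y :: real
  assume "x < y"
  then have "0 < \<gamma> * (y - x)"
    using slopes_withinD(1)[OF assms] by simp
  then show "g x < g y"
    using slopes_withinD(3)[OF assms, of x y] \<open>x < y\<close> by linarith
qed

lemma slopes_within_lipschitz:
  assumes "slopes_within \<gamma> L g"
  shows "L-lipschitz_on UNIV g"
  using slopes_within_abs_le[OF assms] slopes_withinD(1,2)[OF assms]
  by (intro lipschitz_onI) (auto simp: dist_real_def)

lemma slopes_within_measurable:
  assumes "slopes_within \<gamma> L g"
  shows "g \<in> borel_measurable borel"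
  using lipschitz_on_continuous_on[OF slopes_within_lipschitz[OF assms]]
  by (rule borel_measurable_continuous_onI)

text \<open>A Lipschitz function grows at most linearly.\<close>

lemma slopes_within_integrable:
  assumes "slopes_within \<gamma> L g" "finite_measure M" "integrable M Z"
  shows "integrable M (\<lambda>w. g (Z w))"
proof -
  interpret finite_measure M by fact
  note [measurable] = slopes_within_measurable[OF assms(1)] borel_measurable_integrable[OF assms(3)]
  have L: "0 \<le> L"
    using slopes_withinD(1,2)[OF assms(1)] by simp
  have bound: "\<bar>g (Z w)\<bar> \<le> \<bar>g 0\<bar> + L * \<bar>Z w\<bar>" for w
    using slopes_within_abs_le[OF assms(1), of "Z w" 0] by simp
  show ?thesis
  proof (rule Bochner_Integration.integrable_bound)
    show "integrable M (\<lambda>w. \<bar>g 0\<bar> + L * \<bar>Z w\<bar>)"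
      using assms(3) by auto
    show "AE w in M. norm (g (Z w)) \<le> norm (\<bar>g 0\<bar> + L * \<bar>Z w\<bar>)"
      using bound L by (intro AE_I2) simp
  qed measurable
qed

lemma slopes_within_absolutely_continuous:
  assumes "slopes_within \<gamma> L g"
  shows "absolutely_continuous_on S g"
  unfolding absolutely_continuous_on_def
proof (intro allI impI)
  fix \<epsilon> :: real
  assume "0 < \<epsilon>"
  have L: "0 < L"
    using slopes_withinD(1,2)[OF assms] by simp
  show "\<exists>\<delta>>0. \<forall>P. finite P \<and> (\<forall>(s, t)\<in>P. s < t \<and> {s..t} \<subseteq> S) \<and>
    disjoint_family_on (\<lambda>(s, t). {s<..<t}) P \<and> (\<Sum>(s, t)\<in>P. t - s) < \<delta> \<longrightarrow>
    (\<Sum>(s, t)\<in>P. \<bar>g t - g s\<bar>) < \<epsilon>"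
  proof (intro exI[of _ "\<epsilon> / L"] conjI allI impI)
    fix P :: "(real \<times> real) set"
    assume P: "finite P \<and> (\<forall>(s, t)\<in>P. s < t \<and> {s..t} \<subseteq> S) \<and>
      disjoint_family_on (\<lambda>(s, t). {s<..<t}) P \<and> (\<Sum>(s, t)\<in>P. t - s) < \<epsilon> / L"
    have "(\<Sum>(s, t)\<in>P. \<bar>g t - g s\<bar>) \<le> (\<Sum>(s, t)\<in>P. L * (t - s))"
    proof (rule sum_mono, clarify)
      fix s t
      assume "(s, t) \<in> P"
      then have "s < t"
        using P by blast
      then show "\<bar>g t - g s\<bar> \<le> L * (t - s)"
        using slopes_within_abs_le[OF assms, of t s] by simp
    qed
    also have "\<dots> = L * (\<Sum>(s, t)\<in>P. t - s)"
      by (simp add: sum_distrib_left case_prod_unfold)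
    also have "\<dots> < \<epsilon>"
      using P L by (simp add: field_simps)
    finally show "(\<Sum>(s, t)\<in>P. \<bar>g t - g s\<bar>) < \<epsilon>" .
  qed (use \<open>0 < \<epsilon>\<close> L in simp)
qed

lemma slopes_within_utilities:
  assumes "slopes_within \<gamma> L g" "is_cdf F" "F_integrable F (\<lambda>w. w)"
  shows "g \<in> utilities F"
proof -
  interpret P: real_distribution "interval_measure F"
    using assms(2) by (rule real_distribution_interval_measure_is_cdf)
  \<comment> \<open>The limit superior at infinity only sees \<open>1 \<le> m\<close>, where the
    constant \<open>\<bar>g 0\<bar>\<close> is at most \<open>\<bar>g 0\<bar> * m\<close>.\<close>
  have "g m / m \<le> \<bar>g 0\<bar> + L" if "1 \<le> m" for m
  proof -
    have "g m \<le> \<bar>g 0\<bar> * m + L * m"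
      using slopes_withinD(4)[OF assms(1), of 0 m] mult_left_mono[of 1 m "\<bar>g 0\<bar>"] that by simp
    then show ?thesis
      using that by (simp add: field_simps)
  qed
  then have "Limsup at_top (\<lambda>m. ereal (g m / m)) \<le> ereal (\<bar>g 0\<bar> + L)"
    by (intro Limsup_bounded) (auto intro: eventually_mono[OF eventually_ge_at_top[of 1]])
  then have "Limsup at_top (\<lambda>m. ereal (g m / m)) < \<infinity>"
    by auto
  moreover have "F_integrable F g"
    using slopes_within_integrable[OF assms(1) P.finite_measure_axioms assms(3)] .
  ultimately show ?thesis
    using slopes_within_strict_mono[OF assms(1)] slopes_within_absolutely_continuous[OF assms(1)]
    by (simp add: utilities_def)
qed

subsection \<open>Willingness to pay\<close>

text \<open>The value \<open>V\<close> is continuous and decreases at a rate of at least \<gamma>,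
  so it crosses the level \<open>E\<close> exactly once; the definite description therefore denotes
  that crossing.\<close>

lemma informed_value_willingness_to_pay:
  assumes "\<And>\<mu>. informed_value F f B X h u \<mu> = ereal (V \<mu>)"
    and "ext_integral (interval_measure F) u = ereal E"
    and V: "slopes_within \<gamma> L (\<lambda>\<mu>. - V \<mu>)" and "E \<le> V 0"
  shows "V (willingness_to_pay F f B X h u) = E"
proof -
  have mono: "V y < V x" if "x < y" for x y
    using slopes_within_strict_mono[OF V] that by (simp add: strict_mono_def)
  \<comment> \<open>At rate \<gamma> or faster, \<open>V\<close> has fallen to \<open>E\<close> or
    below after this distance.\<close>
  define b where "b = (V 0 - E) / \<gamma>"
  have "0 < \<gamma>"
    using slopes_withinD(1)[OF V] .
  then have b: "0 \<le> b" "\<gamma> * b = V 0 - E"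
    using assms(4) by (auto simp: b_def)
  then have "V b \<le> E"
    using slopes_withinD(3)[OF V, of 0 b] by simp
  moreover have "continuous_on {0..b} V"
    using continuous_on_minus[OF lipschitz_on_continuous_on[OF slopes_within_lipschitz[OF V]]]
    by (auto intro: continuous_on_subset)
  ultimately obtain M where M: "0 \<le> M" "V M = E"
    using IVT2'[of V b E 0] assms(4) b(1) by auto
  have "willingness_to_pay F f B X h u = M"
    unfolding willingness_to_pay_def assms(1,2)
  proof (rule the_equality)
    show "0 \<le> M \<and> (\<forall>\<mu>>M. ereal (V \<mu>) < ereal E) \<and> (\<forall>\<mu>. 0 \<le> \<mu> \<and> \<mu> < M \<longrightarrow> ereal E < ereal (V \<mu>))"
      using M mono by auto
  next
    fix M'
    assume M': "0 \<le> M' \<and> (\<forall>\<mu>>M'. ereal (V \<mu>) < ereal E) \<and> (\<forall>\<mu>. 0 \<le> \<mu> \<and> \<mu> < M' \<longrightarrow> ereal E < ereal (V \<mu>))"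
    show "M' = M"
      \<comment> \<open>If \<open>M'\<close> differed from \<open>M\<close>, one of its two clauses,
        taken at the price \<open>M\<close>, would contradict \<open>V M = E\<close>.\<close>
      using M M' by (cases M M' rule: linorder_cases) auto
  qed
  then show ?thesis
    using M by simp
qed

lemma SUP_ereal_eq_Max:
  fixes W :: "'a \<Rightarrow> real"
  assumes "finite S" "S \<noteq> {}"
  shows "(SUP s\<in>S. ereal (W s)) = ereal (Max (W ` S))"
proof (rule antisym)
  show "(SUP s\<in>S. ereal (W s)) \<le> ereal (Max (W ` S))"
    using assms by (intro SUP_least) auto
  have "Max (W ` S) \<in> W ` S"
    using assms by (intro Max_in) auto
  then show "ereal (Max (W ` S)) \<le> (SUP s\<in>S. ereal (W s))"
    by (auto intro!: SUP_upper2)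
qed

text \<open>A maximiser at one price is still a competitor at the other: the one at \<open>y\<close>
  bounds the drop of the maximum from below, the one at \<open>x\<close> bounds it from
  above.\<close>

lemma slopes_within_Max:
  fixes W :: "'a \<Rightarrow> real \<Rightarrow> real"
  assumes "finite S" "S \<noteq> {}" and W: "\<And>s. s \<in> S \<Longrightarrow> slopes_within \<gamma> L (\<lambda>\<mu>. - W s \<mu>)"
  shows "slopes_within \<gamma> L (\<lambda>\<mu>. - Max ((\<lambda>s. W s \<mu>) ` S))"
  unfolding slopes_within_def
proof (intro conjI allI impI)
  show "0 < \<gamma>"
    using assms slopes_withinD(1)[OF W] by auto
next
  fix x y :: real
  assume "x \<le> y"
  have in_img: "Max ((\<lambda>s. W s z) ` S) \<in> (\<lambda>s. W s z) ` S" for z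
    using assms by (intro Max_in) auto
  have ge: "W s z \<le> Max ((\<lambda>s. W s z) ` S)" if "s \<in> S" for s z
    using that assms by auto
  obtain s where s: "s \<in> S" "Max ((\<lambda>s. W s y) ` S) = W s y"
    using in_img[of y] by auto
  show "\<gamma> * (y - x) \<le> - Max ((\<lambda>s. W s y) ` S) - - Max ((\<lambda>s. W s x) ` S)"
    using slopes_withinD(3)[OF W[OF s(1)] \<open>x \<le> y\<close>] ge[OF s(1), of x] s(2) by linarith
  obtain s where s: "s \<in> S" "Max ((\<lambda>s. W s x) ` S) = W s x"
    using in_img[of x] by auto
  show "- Max ((\<lambda>s. W s y) ` S) - - Max ((\<lambda>s. W s x) ` S) \<le> L * (y - x)"
    using slopes_withinD(4)[OF W[OF s(1)] \<open>x \<le> y\<close>] ge[OF s(1), of y] s(2) by linarith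
qed

text \<open>The optimal value is strictly decreasing in the price and equals \<open>E\<close> at the
  willingness to pay, so the latter is compared with \<open>a\<close> by comparing the value at
  \<open>a\<close> with \<open>E\<close>. An upper bound must consider all strategies; a lower bound
  needs just one. The strategy \<open>\<beta>0\<close> ensures that the value starts at
  \<open>E\<close> or above.\<close>

lemma willingness_to_pay_compare:
  fixes W :: "(real \<Rightarrow> real \<Rightarrow> real) \<Rightarrow> real \<Rightarrow> real"
  assumes S: "finite (strategies B X)"
    and W: "\<And>\<beta> \<mu>. \<beta> \<in> strategies B X \<Longrightarrow>
      ext_integral (interval_measure (outcome_cdf F f X h \<beta> \<mu>)) u = ereal (W \<beta> \<mu>)"
    and E: "ext_integral (interval_measure F) u = ereal E"
    and slopes: "\<And>\<beta>. \<beta> \<in> strategies B X \<Longrightarrow> slopes_within \<gamma> L (\<lambda>\<mu>. - W \<beta> \<mu>)"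
    and \<beta>0: "\<beta>0 \<in> strategies B X" "E \<le> W \<beta>0 0"
  shows "(\<And>\<beta>. \<beta> \<in> strategies B X \<Longrightarrow> W \<beta> a < E) \<Longrightarrow> willingness_to_pay F f B X h u < a"
    and "\<beta> \<in> strategies B X \<Longrightarrow> E < W \<beta> a \<Longrightarrow> a < willingness_to_pay F f B X h u"
proof -
  define V where "V \<mu> = Max ((\<lambda>\<beta>. W \<beta> \<mu>) ` strategies B X)" for \<mu>
  have ne: "strategies B X \<noteq> {}"
    using \<beta>0 by auto
  have V: "slopes_within \<gamma> L (\<lambda>\<mu>. - V \<mu>)"
    unfolding V_def using slopes_within_Max[OF S ne slopes] .
  have ge: "W \<beta> \<mu> \<le> V \<mu>" if "\<beta> \<in> strategies B X" for \<beta> \<mu>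
    unfolding V_def using that S by auto
  have "informed_value F f B X h u \<mu> = ereal (V \<mu>)" for \<mu>
    unfolding informed_value_def V_def SUP_ereal_eq_Max[OF S ne, symmetric]
    by (intro SUP_cong) (auto simp: W)
  then have M: "V (willingness_to_pay F f B X h u) = E" (is "V ?M = E")
    using informed_value_willingness_to_pay[OF _ E V] ge[OF \<beta>0(1), of 0] \<beta>0(2) by force
  have less: "V x < V y \<longleftrightarrow> y < x" for x y
    using strict_mono_less[OF slopes_within_strict_mono[OF V], of y x] by simp
  show "?M < a" if "\<And>\<beta>. \<beta> \<in> strategies B X \<Longrightarrow> W \<beta> a < E"
  proof -
    have "V a < V ?M"
      unfolding M using that S ne by (auto simp: V_def)
    then show ?thesis
      by (simp add: less)
  qed
  show "a < ?M" if "\<beta> \<in> strategies B X" "E < W \<beta> a"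
    using ge[OF that(1), of a] that(2) less[of ?M a] M by simp
qed

subsection \<open>Log-convexity\<close>

lemma four_mult_le_power2_add: "4 * (x * y) \<le> (x + y) ^ 2" for x y :: real
  using zero_le_power2[of "x - y"] by (simp add: power2_eq_square algebra_simps)

lemma strictly_convex_on_ln_midpoint:
  assumes "strictly_convex_on S (\<lambda>w. ln (f w))" and pos: "\<And>w. w \<in> S \<Longrightarrow> 0 < f w"
    and "x \<in> S" "y \<in> S" "x \<noteq> y"
  shows "f ((x + y) / 2) ^ 2 < f x * f y"
proof -
  have eq: "(1 - 1/2) * x + 1/2 * y = (x + y) / 2"
    by simp
  have "convex S" using assms(1) by (simp add: strictly_convex_on_def)
  then have mem: "(x + y) / 2 \<in> S"
    using convexD[of S x y "1/2" "1/2"] assms(3,4) by (simp add: add_divide_distrib)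
  have "\<forall>t. x \<noteq> y \<and> 0 < t \<and> t < 1 \<longrightarrow> ln (f ((1 - t) * x + t * y)) < (1 - t) * ln (f x) + t * ln (f y)"
    using assms(1,3,4) by (simp add: strictly_convex_on_def)
  from this[rule_format, of "1/2"] have "2 * ln (f ((x + y) / 2)) < ln (f x) + ln (f y)"
    using assms(5) unfolding eq by simp
  moreover have "0 < f ((x + y) / 2)" "0 < f x" "0 < f y"
    using pos mem assms(3,4) by auto
  ultimately have "ln (f ((x + y) / 2) ^ 2) < ln (f x * f y)"
    by (simp add: ln_realpow ln_mult_pos)
  with \<open>0 < f ((x + y) / 2)\<close> \<open>0 < f x\<close> \<open>0 < f y\<close> show ?thesis
    by (subst (asm) ln_less_cancel_iff) auto
qed

text \<open>The effect of unit shifts on \<open>min w k\<close>: raising \<open>w\<close> by 1 adds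
  \<open>ramp (k - w)\<close>, and lowering it by 1 subtracts
  \<open>ramp (k + 1 - w)\<close>.\<close>

definition ramp :: "real \<Rightarrow> real" where
  "ramp s = max 0 (min s 1)"

lemma ramp_measurable [measurable]: "ramp \<in> borel_measurable borel"
  unfolding ramp_def by measurable

lemma ramp_bounds: "0 \<le> ramp s" "ramp s \<le> 1" "ramp s = 0 \<longleftrightarrow> s \<le> 0"
  by (auto simp: ramp_def)

text \<open>The function called \<open>H\<close> in the overview.\<close>

definition ramp_mean :: "(real \<Rightarrow> real) \<Rightarrow> real \<Rightarrow> real" where
  "ramp_mean F k = (\<integral>w. ramp (k - w) \<partial>interval_measure F)"

lemma integrable_ramp:
  assumes "is_cdf F"
  shows "F_integrable F (\<lambda>w. ramp (k - w))"
proof -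
  interpret P: real_distribution "interval_measure F"
    using assms(1) by (rule real_distribution_interval_measure_is_cdf)
  show ?thesis
    by (rule P.integrable_const_bound[where B=1]) (auto simp: ramp_bounds)
qed

lemma not_AE_lborel_ge: "\<not> (AE w in lborel. (k :: real) \<le> w)"
proof
  assume "AE w in lborel. k \<le> w"
  then have "AE w in lborel. w \<notin> {..<k}"
    by (rule eventually_mono) auto
  then have "{..<k} \<in> null_sets (lborel :: real measure)"
    by (subst (asm) AE_iff_null_sets[symmetric]) auto
  then have "{k - 1<..<k} \<in> null_sets (lborel :: real measure)"
    by (rule null_sets_subset) auto
  then have "emeasure lborel {k - 1<..<k} = 0"
    by (rule null_setsD1)
  then show False
    by simp
qed

text \<open>If the integrals agreed, the nonnegative difference would vanish almost everywhere,
  although it is positive on a half-line, which is not a null set.\<close>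

lemma lborel_integral_less:
  fixes g h :: "real \<Rightarrow> real"
  assumes "integrable lborel g" "integrable lborel h"
    and le: "\<And>w. g w \<le> h w" and less: "\<And>w. w < k \<Longrightarrow> g w < h w"
  shows "(\<integral>w. g w \<partial>lborel) < (\<integral>w. h w \<partial>lborel)"
proof -
  have "(\<integral>w. h w - g w \<partial>lborel) \<noteq> 0"
  proof
    assume "(\<integral>w. h w - g w \<partial>lborel) = 0"
    then have "AE w in lborel. h w - g w = 0"
      using assms by (subst (asm) integral_nonneg_eq_0_iff_AE) auto
    then have "AE w in lborel. k \<le> w"
    proof (rule eventually_mono)
      show "k \<le> w" if "h w - g w = 0" for w
        using that less[of w] by (cases "w < k") auto
    qed
    then show False
      using not_AE_lborel_ge by blast
  qed
  moreover have "0 \<le> (\<integral>w. h w - g w \<partial>lborel)"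
    by (intro Bochner_Integration.integral_nonneg) (simp add: le)
  ultimately show ?thesis
    using assms(1,2) by simp
qed

lemma measure_lessThan_pos:
  assumes "is_cdf F" "has_density F f" "\<And>w. w < k \<Longrightarrow> 0 < f w"
  shows "0 < measure (interval_measure F) {..<k}"
proof -
  interpret P: real_distribution "interval_measure F"
    using assms(1) by (rule real_distribution_interval_measure_is_cdf)
  note f[measurable] = has_densityD[OF assms(2)]
  have "emeasure (interval_measure F) {..<k} \<noteq> 0"
  proof
    assume "emeasure (interval_measure F) {..<k} = 0"
    then have "(\<integral>\<^sup>+ w. ennreal (f w) * indicator {..<k} w \<partial>lborel) = 0"
      unfolding f(3) by (subst (asm) emeasure_density) auto
    then have "AE w in lborel. ennreal (f w) * indicator {..<k} w = 0"
      by (subst (asm) nn_integral_0_iff_AE) auto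
    then have "AE w in lborel. k \<le> w"
    proof (rule eventually_mono)
      show "k \<le> w" if "ennreal (f w) * indicator {..<k} w = 0" for w
        using that assms(3)[of w] by (cases "w < k") (auto simp: ennreal_eq_0_iff)
    qed
    then show False
      using not_AE_lborel_ge by blast
  qed
  then show ?thesis
    by (simp add: P.emeasure_eq_measure zero_less_measure_iff)
qed

lemma ramp_mean_pos:
  assumes "is_cdf F" "has_density F f" "\<And>w. w < k \<Longrightarrow> 0 < f w"
  shows "0 < ramp_mean F k"
proof -
  interpret P: real_distribution "interval_measure F"
    using assms(1) by (rule real_distribution_interval_measure_is_cdf)
  have pos: "0 < measure (interval_measure F) {..<k}"
    using assms by (rule measure_lessThan_pos)
  have "ramp (k - w) \<noteq> 0" if "w < k" for w
    using that by (simp add: ramp_bounds)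
  then have "(\<integral>w. 0 \<partial>interval_measure F) < (\<integral>w. ramp (k - w) \<partial>interval_measure F)"
    using integrable_ramp[OF assms(1)] pos
    by (intro P.integral_less_AE[where A="{..<k}"])
      (auto simp: ramp_bounds(1) P.emeasure_eq_measure intro!: AE_I2 dest: sym)
  then show ?thesis
    by (simp add: ramp_mean_def)
qed

text \<open>Translation invariance moves the shift from the ramp to the density, so that ramp means
  at different points become integrals against one common kernel.\<close>

lemma ramp_mean_shift:
  assumes "is_cdf F" "has_density F f"
  shows "integrable lborel (\<lambda>w. f (w + t) * ramp (k - w))"
    and "(\<integral>w. f (w + t) * ramp (k - w) \<partial>lborel) = ramp_mean F (k + t)"
proof -
  have *: "integrable lborel (\<lambda>w. f w * ramp (k + t - w))"
    using integrable_ramp[OF assms(1)] integral_has_density(2)[OF assms(2), of "\<lambda>w. ramp (k + t - w)"] by simp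
  show "integrable lborel (\<lambda>w. f (w + t) * ramp (k - w))"
    using lborel_integrable_real_affine[OF *, of 1 t] by (simp add: add.commute algebra_simps)
  show "(\<integral>w. f (w + t) * ramp (k - w) \<partial>lborel) = ramp_mean F (k + t)"
    unfolding ramp_mean_def using integral_has_density(1)[OF assms(2), of "\<lambda>w. ramp (k + t - w)"]
      lborel_integral_real_affine[of 1 "\<lambda>w. f w * ramp (k + t - w)" t]
    by (simp add: add.commute algebra_simps)
qed

text \<open>Convolution with a positive kernel preserves log-convexity by the Cauchy-Schwarz inequality,
  obtained here from AM-GM with a free weight \<open>t\<close>.\<close>

lemma ramp_mean_strictly_log_convex:
  assumes "is_cdf F" "has_density F f" "\<And>w. w < k + 1 \<Longrightarrow> 0 < f w"
    and "strictly_convex_on {..<k + 1} (\<lambda>w. ln (f w))"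
  shows "ramp_mean F k ^ 2 < ramp_mean F (k - 1) * ramp_mean F (k + 1)"
proof -
  define a b where "a = ramp_mean F (k - 1)" and "b = ramp_mean F (k + 1)"
  have ab: "0 < a" "0 < b"
    unfolding a_def b_def using assms by (auto intro!: ramp_mean_pos)
  \<comment> \<open>This weight minimises \<open>t * a + b / t\<close>, with minimum twice the
    geometric mean of \<open>a\<close> and \<open>b\<close>.\<close>
  define t where "t = sqrt (b / a)"
  have t: "0 < t" "t ^ 2 = b / a"
    using ab by (auto simp: t_def)
  \<comment> \<open>Strict log-convexity at the midpoint \<open>w\<close> of \<open>w - 1\<close>
    and \<open>w + 1\<close>. Both points lie in its range exactly when \<open>w < k\<close>, which
    is also where the kernel is positive.\<close>
  have am_gm: "2 * f w < t * f (w - 1) + f (w + 1) / t" if "w < k" for w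
  proof -
    have "f w ^ 2 < f (w - 1) * f (w + 1)"
      using strictly_convex_on_ln_midpoint[OF assms(4), of "w - 1" "w + 1"] assms(3) that by simp
    then have "(2 * f w) ^ 2 < 4 * ((t * f (w - 1)) * (f (w + 1) / t))"
      using t by (simp add: power_mult_distrib)
    also have "\<dots> \<le> (t * f (w - 1) + f (w + 1) / t) ^ 2"
      by (rule four_mult_le_power2_add)
    finally show ?thesis
      using assms(3)[of "w - 1"] assms(3)[of "w + 1"] that t
      by (intro power_less_imp_less_base[of "2 * f w" 2]) (auto intro!: add_nonneg_nonneg less_imp_le)
  qed
  note shift = ramp_mean_shift[OF assms(1,2)]
  \<comment> \<open>The forms \<open>w + 0\<close> and \<open>w + -1\<close> make all three terms
    instances of the shift lemma.\<close>
  have "(\<integral>w. 2 * (f (w + 0) * ramp (k - w)) \<partial>lborel) <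
    (\<integral>w. t * (f (w + -1) * ramp (k - w)) + (f (w + 1) * ramp (k - w)) / t \<partial>lborel)"
  proof (rule lborel_integral_less[where k=k])
    show less: "2 * (f (w + 0) * ramp (k - w)) <
      t * (f (w + -1) * ramp (k - w)) + (f (w + 1) * ramp (k - w)) / t" if "w < k" for w
    proof -
      have "0 < ramp (k - w)"
        using that by (simp add: ramp_def)
      then have "2 * f w * ramp (k - w) < (t * f (w - 1) + f (w + 1) / t) * ramp (k - w)"
        using am_gm[OF that] by simp
      then show ?thesis
        by (simp add: algebra_simps)
    qed
    show "2 * (f (w + 0) * ramp (k - w)) \<le>
      t * (f (w + -1) * ramp (k - w)) + (f (w + 1) * ramp (k - w)) / t" for w
    proof (cases "w < k")
      case True
      then show ?thesis
        by (intro less_imp_le less)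
    next
      case False
      then have "ramp (k - w) = 0"
        by (simp add: ramp_bounds(3))
      then show ?thesis
        by simp
    qed
    show "integrable lborel (\<lambda>w. 2 * (f (w + 0) * ramp (k - w)))"
      using shift(1)[of 0 k] by (rule integrable_mult_right)
    show "integrable lborel (\<lambda>w. t * (f (w + -1) * ramp (k - w)) + (f (w + 1) * ramp (k - w)) / t)"
      using shift(1)[of "-1" k] shift(1)[of 1 k] by (intro Bochner_Integration.integrable_add integrable_mult_right integrable_divide)
  qed
  then have "2 * ramp_mean F k < t * a + b / t"
    using shift[of 0 k] shift[of "-1" k] shift[of 1 k] by (simp add: a_def b_def)
  also have "t * a + b / t = 2 * (t * a)"
  proof -
    have "t ^ 2 * a = b"
      using t ab by simp
    then have "b / t = t * a"
      using t(1) by (simp add: power2_eq_square divide_eq_eq ac_simps)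
    then show ?thesis
      by simp
  qed
  finally have "ramp_mean F k < t * a"
    by simp
  moreover have "0 < ramp_mean F k"
    using assms by (auto intro!: ramp_mean_pos)
  ultimately have "ramp_mean F k ^ 2 < (t * a) ^ 2"
    by (intro power_strict_mono) auto
  also have "(t * a) ^ 2 = t ^ 2 * a * a"
    by (simp add: power2_eq_square)
  also have "\<dots> = a * b"
    using t(2) ab by simp
  finally show ?thesis
    by (simp add: a_def b_def)
qed

subsection \<open>The two-asset environment\<close>

lemma linear_order_on_pair: "linear_order_on {a, b} {(a, a), (a, b), (b, b)}"
  unfolding linear_order_on_def partial_order_on_def preorder_on_def refl_on_def
    trans_def antisym_def total_on_def
  by blast

text \<open>The last assumption makes the expected loss below \<open>ws\<close> at least as large as
  the best gain 2. The bound on the mass of \<open>{..ws}\<close> gives the high signal positive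
  probability.\<close>

locale step_environment =
  fixes F f :: "real \<Rightarrow> real" and q A ws :: real
  assumes cdf: "is_cdf F" and density: "has_density F f"
    and integrable_state: "F_integrable F (\<lambda>w. w)"
    and q: "0 < q" "q < 1"
    and ws: "measure (interval_measure F) {..ws} < 1"
    and A: "0 \<le> A" "2 \<le> A * measure (interval_measure F) {..<ws}"
begin

sublocale P: real_distribution "interval_measure F"
  using cdf by (rule real_distribution_interval_measure_is_cdf)

lemma prob_UNIV: "measure (interval_measure F) UNIV = 1"
  using P.prob_space by simp

text \<open>The value 0 at \<open>ws\<close> is forced: at the crossing point of an investment menu
  both inequalities apply, so the two assets must agree there.\<close>

definition asset :: "real \<Rightarrow> real" where
  "asset w = (if w < ws then - A else if w = ws then 0 else 2)"

definition signal :: "real \<Rightarrow> real pmf" where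
  "signal w = map_pmf of_bool (bernoulli_pmf (if ws < w then q else 0))"

abbreviation menu :: "(real \<Rightarrow> real) set" where
  "menu \<equiv> {\<lambda>_. 0, asset}"

abbreviation signals :: "real set" where
  "signals \<equiv> {0, 1}"

lemma pmf_signal:
  "pmf (signal w) 0 = (if ws < w then 1 - q else 1)"
  "pmf (signal w) 1 = (if ws < w then q else 0)"
proof -
  have inj: "inj (of_bool :: bool \<Rightarrow> real)"
    by (rule injI) (auto simp: of_bool_eq_iff)
  show "pmf (signal w) 0 = (if ws < w then 1 - q else 1)"
    using pmf_map_inj'[OF inj, of "bernoulli_pmf (if ws < w then q else 0)" False] q
    by (simp add: signal_def)
  show "pmf (signal w) 1 = (if ws < w then q else 0)"
    using pmf_map_inj'[OF inj, of "bernoulli_pmf (if ws < w then q else 0)" True] q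
    by (simp add: signal_def)
qed

lemma pmf_signal_measurable:
  assumes "x \<in> signals"
  shows "(\<lambda>w. pmf (signal w) x) \<in> borel_measurable borel"
  using assms by (auto simp: pmf_signal)

lemma asset_mono: "mono asset"
  using A by (auto simp: mono_def asset_def)

lemma asset_measurable: "asset \<in> borel_measurable borel"
  using asset_mono by (rule borel_measurable_mono)

lemma integrable_asset: "F_integrable F asset"
  using A(1) asset_measurable by (intro P.integrable_const_bound[where B="A + 2"]) (auto simp: asset_def)

lemma menu_integrable:
  assumes "b \<in> menu"
  shows "b \<in> borel_measurable borel" "F_integrable F b"
  using assms asset_measurable integrable_asset by auto

lemma investment_menu: "is_investment_menu F menu"
proof -
  have ball: "b \<in> L1_ball F b 1" if "b \<in> menu" for b
    using menu_integrable[OF that] by (simp add: L1_ball_def)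
  have "menu \<subseteq> topspace (L1_topology F)"
  proof
    fix b
    assume b: "b \<in> menu"
    then have "L1_ball F b 1 \<in> {L1_ball F b e |b e. F_integrable F b \<and> 0 < e}"
      using menu_integrable(2)[OF b] zero_less_one by blast
    then show "b \<in> topspace (L1_topology F)"
      unfolding L1_topology_def topology_generated_by_topspace using ball[OF b] by blast
  qed
  then have "compactin (L1_topology F) menu"
    by (rule finite_imp_compactin) simp
  then have "is_menu F menu"
    using menu_integrable(2) unfolding is_menu_def by blast
  moreover have "\<forall>b\<in>menu. mono b"
    using asset_mono by (auto simp: mono_def)
  moreover have "linear_order_on menu {(\<lambda>_. 0, \<lambda>_. 0), (\<lambda>_. 0, asset), (asset, asset)}"
    by (rule linear_order_on_pair)
  moreover have "(\<forall>w. ereal w \<le> ereal ws \<longrightarrow> b' w \<le> b w) \<and> (\<forall>w. ereal ws \<le> ereal w \<longrightarrow> b w \<le> b' w)"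
    if "(b, b') \<in> {(\<lambda>_. 0, \<lambda>_. 0), (\<lambda>_. 0, asset), (asset, asset)}" for b b'
  proof -
    have "asset w \<le> 0" if "w \<le> ws" for w
      using that A(1) by (simp add: asset_def)
    moreover have "0 \<le> asset w" if "ws \<le> w" for w
      using that by (simp add: asset_def)
    ultimately show ?thesis
      using that by fastforce
  qed
  ultimately show ?thesis
    unfolding is_investment_menu_def by blast
qed

lemma integrable_indicator_state:
  assumes "S \<in> sets borel"
  shows "F_integrable F (indicator S :: real \<Rightarrow> real)"
  using assms by (intro P.integrable_const_bound[where B=1]) auto

text \<open>The high signal has probability \<open>q\<close> times the mass above \<open>ws\<close>,
  which is positive and at most \<open>q < 1\<close>; hence the low signal has positive probability
  too.\<close>

lemma signal_experiment: "is_experiment F signals signal"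
proof -
  have "(\<integral>w. indicator {ws<..} w \<partial>interval_measure F) = 1 - measure (interval_measure F) {..ws}"
    using P.prob_compl[of "{..ws}"] by (simp add: Compl_eq_Diff_UNIV[symmetric])
  moreover have "pmf (signal w) 1 = q * indicator {ws<..} w"
    and "pmf (signal w) 0 = 1 - q * indicator {ws<..} w" for w
    by (simp_all add: pmf_signal)
  ultimately have prob: "signal_prob F signal 1 = q * (1 - measure (interval_measure F) {..ws})"
    "signal_prob F signal 0 = 1 - q * (1 - measure (interval_measure F) {..ws})"
    using integrable_indicator_state[of "{ws<..}"] by (simp_all add: signal_prob_def prob_UNIV)
  have "q * (1 - measure (interval_measure F) {..ws}) \<le> q * 1"
    using q by (intro mult_left_mono) auto
  then have "q * (1 - measure (interval_measure F) {..ws}) < 1"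
    using q by linarith
  then have "0 < signal_prob F signal x" if "x \<in> signals" for x
    using that q ws by (auto simp: prob)
  then show ?thesis
    using pmf_signal_measurable by (auto simp: is_experiment_def signal_def)
qed

text \<open>In the only nontrivial case, signals 0 and 1, either the lower state never sends 1, or
  both states lie above \<open>ws\<close> and have the same signal law.\<close>

lemma MLR: "MLR_ordered signals signal"
  using q by (auto simp: MLR_ordered_def pmf_signal mult.commute)

text \<open>Conditional expected utility in state \<open>w\<close> when \<open>b0\<close> is held
  after signal 0 and \<open>b1\<close> after signal 1. Averaging over signals first lets strategies
  be compared state by state.\<close>

definition payoff :: "(real \<Rightarrow> real) \<Rightarrow> (real \<Rightarrow> real) \<Rightarrow> real \<Rightarrow> (real \<Rightarrow> real) \<Rightarrow> real \<Rightarrow> real" where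
  "payoff b0 b1 \<mu> g w =
     pmf (signal w) 0 * g (w + b0 w - \<mu>) + pmf (signal w) 1 * g (w + b1 w - \<mu>)"

lemma payoff_le:
  assumes "g (w + b0 w - \<mu>) \<le> c" "g (w + b1 w - \<mu>) \<le> c"
  shows "payoff b0 b1 \<mu> g w \<le> c"
proof -
  have "payoff b0 b1 \<mu> g w \<le> pmf (signal w) 0 * c + pmf (signal w) 1 * c"
    unfolding payoff_def using assms by (intro add_mono mult_left_mono) auto
  also have "\<dots> = c"
    by (simp add: pmf_signal algebra_simps)
  finally show ?thesis .
qed

lemma integrable_pmf_signal_mult:
  assumes "slopes_within \<gamma> L g" "b \<in> menu" "x \<in> signals"
  shows "F_integrable F (\<lambda>w. pmf (signal w) x * g (w + b w - \<mu>))"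
proof -
  have g: "F_integrable F (\<lambda>w. g (w + b w - \<mu>))"
    using integrable_state menu_integrable(2)[OF assms(2)]
    by (intro slopes_within_integrable[OF assms(1) P.finite_measure_axioms]
        Bochner_Integration.integrable_diff Bochner_Integration.integrable_add) auto
  have [measurable]: "(\<lambda>w. pmf (signal w) x) \<in> borel_measurable (interval_measure F)"
    using pmf_signal_measurable[OF assms(3)] by simp
  have [measurable]: "(\<lambda>w. g (w + b w - \<mu>)) \<in> borel_measurable (interval_measure F)"
    using g by (rule borel_measurable_integrable)
  show ?thesis
  proof (rule Bochner_Integration.integrable_bound[OF g])
    show "AE w in interval_measure F. norm (pmf (signal w) x * g (w + b w - \<mu>)) \<le> norm (g (w + b w - \<mu>))"
      by (intro AE_I2) (simp add: abs_mult pmf_le_1 mult_left_le_one_le)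
  qed measurable
qed

lemma integrable_payoff:
  assumes "slopes_within \<gamma> L g" "b0 \<in> menu" "b1 \<in> menu"
  shows "F_integrable F (payoff b0 b1 \<mu> g)"
  unfolding payoff_def
  by (intro Bochner_Integration.integrable_add integrable_pmf_signal_mult[OF assms(1)] assms(2,3)) auto

definition expected_payoff :: "(real \<Rightarrow> real) \<Rightarrow> (real \<Rightarrow> real) \<Rightarrow> (real \<Rightarrow> real) \<Rightarrow> real \<Rightarrow> real" where
  "expected_payoff g b0 b1 \<mu> = (\<integral>w. payoff b0 b1 \<mu> g w \<partial>interval_measure F)"

lemma strategies_menu:
  assumes "\<beta> \<in> strategies menu signals"
  shows "\<beta> 0 \<in> menu" "\<beta> 1 \<in> menu"
  using PiE_mem[OF assms[unfolded strategies_def], of 0] PiE_mem[OF assms[unfolded strategies_def], of 1]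
  by simp_all

lemma ext_integral_outcome_cdf_payoff:
  assumes "slopes_within \<gamma> L g" "\<beta> \<in> strategies menu signals"
  shows "ext_integral (interval_measure (outcome_cdf F f signals signal \<beta> \<mu>)) g =
    ereal (expected_payoff g (\<beta> 0) (\<beta> 1) \<mu>)"
proof -
  note menu = strategies_menu[OF assms(2)]
  have "\<beta> x \<in> menu" if "x \<in> signals" for x
    using that menu by auto
  then have "ext_integral (interval_measure (outcome_cdf F f signals signal \<beta> \<mu>)) g =
    ereal (\<Sum>x\<in>signals. \<integral>w. pmf (signal w) x * g (w + \<beta> x w - \<mu>) \<partial>interval_measure F)"
    by (intro ext_integral_outcome_cdf cdf density signal_experiment menu_integrable(1)
        slopes_within_measurable[OF assms(1)] integrable_pmf_signal_mult[OF assms(1)]) auto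
  also have "\<dots> = ereal (expected_payoff g (\<beta> 0) (\<beta> 1) \<mu>)"
    unfolding expected_payoff_def payoff_def
    by (subst Bochner_Integration.integral_add)
      (use integrable_pmf_signal_mult[OF assms(1) menu(1)] integrable_pmf_signal_mult[OF assms(1) menu(2)] in auto)
  finally show ?thesis .
qed

text \<open>The signal probabilities sum to one in every state, so the slope in the price is an
  average of slopes of \<open>g\<close>.\<close>

lemma slopes_within_expected_payoff:
  assumes "slopes_within \<gamma> L g" "b0 \<in> menu" "b1 \<in> menu"
  shows "slopes_within \<gamma> L (\<lambda>\<mu>. - expected_payoff g b0 b1 \<mu>)"
  unfolding slopes_within_def
proof (intro conjI allI impI)
  show "0 < \<gamma>"
    using slopes_withinD(1)[OF assms(1)] .
  fix x y :: real
  assume xy: "x \<le> y"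
  note int = integrable_payoff[OF assms]
  have sum: "c = pmf (signal w) 0 * c + pmf (signal w) 1 * c" for c w
    by (simp add: pmf_signal algebra_simps)
  have diff: "payoff b0 b1 x g w - payoff b0 b1 y g w =
    pmf (signal w) 0 * (g (w + b0 w - x) - g (w + b0 w - y)) +
    pmf (signal w) 1 * (g (w + b1 w - x) - g (w + b1 w - y))" for w
    by (simp add: payoff_def algebra_simps)
  have slope: "\<gamma> * (y - x) \<le> g (m - x) - g (m - y)" "g (m - x) - g (m - y) \<le> L * (y - x)" for m
    using slopes_withinD(3,4)[OF assms(1), of "m - y" "m - x"] xy by simp_all
  have eq: "- expected_payoff g b0 b1 y - - expected_payoff g b0 b1 x =
    (\<integral>w. payoff b0 b1 x g w - payoff b0 b1 y g w \<partial>interval_measure F)"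
    unfolding expected_payoff_def using int by simp
  have "\<gamma> * (y - x) = (\<integral>w. \<gamma> * (y - x) \<partial>interval_measure F)"
    by (simp add: prob_UNIV)
  also have "\<dots> \<le> - expected_payoff g b0 b1 y - - expected_payoff g b0 b1 x"
    unfolding eq
  proof (rule integral_mono)
    show "\<gamma> * (y - x) \<le> payoff b0 b1 x g w - payoff b0 b1 y g w" for w
      unfolding diff by (subst sum[of _ w]) (intro add_mono mult_left_mono slope pmf_nonneg)
  qed (use int in auto)
  finally show "\<gamma> * (y - x) \<le> - expected_payoff g b0 b1 y - - expected_payoff g b0 b1 x" .
  have "- expected_payoff g b0 b1 y - - expected_payoff g b0 b1 x \<le> (\<integral>w. L * (y - x) \<partial>interval_measure F)"
    unfolding eq
  proof (rule integral_mono)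
    show "payoff b0 b1 x g w - payoff b0 b1 y g w \<le> L * (y - x)" for w
      unfolding diff by (subst (3) sum[of _ w]) (intro add_mono mult_left_mono slope pmf_nonneg)
  qed (use int in auto)
  then show "- expected_payoff g b0 b1 y - - expected_payoff g b0 b1 x \<le> L * (y - x)"
    by (simp add: prob_UNIV)
qed

lemma integrable_utility:
  assumes "slopes_within \<gamma> L g"
  shows "F_integrable F g"
  using slopes_within_integrable[OF assms P.finite_measure_axioms integrable_state] .

lemma finite_strategies: "finite (strategies menu signals)"
  unfolding strategies_def by (intro finite_PiE) auto

lemma expected_payoff_zero: "expected_payoff g (\<lambda>_. 0) (\<lambda>_. 0) 0 = (\<integral>w. g w \<partial>interval_measure F)"
  unfolding expected_payoff_def payoff_def by (intro Bochner_Integration.integral_cong) (auto simp: pmf_signal algebra_simps)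

lemma willingness_to_pay_cases:
  assumes "slopes_within \<gamma> L g"
  shows "(\<And>b0 b1. b0 \<in> menu \<Longrightarrow> b1 \<in> menu \<Longrightarrow> expected_payoff g b0 b1 a < (\<integral>w. g w \<partial>interval_measure F)) \<Longrightarrow>
      willingness_to_pay F f menu signals signal g < a"
    and "b0 \<in> menu \<Longrightarrow> b1 \<in> menu \<Longrightarrow> (\<integral>w. g w \<partial>interval_measure F) < expected_payoff g b0 b1 a \<Longrightarrow>
      a < willingness_to_pay F f menu signals signal g"
proof -
  \<comment> \<open>A pair of assets encodes a strategy; restriction to \<open>signals\<close> gives
    the extensional function that \<open>strategies\<close> demands.\<close>
  let ?\<beta> = "\<lambda>b0 b1. \<lambda>x\<in>signals. if x = 0 then b0 else b1 :: real \<Rightarrow> real"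
  have \<beta>: "?\<beta> b0 b1 \<in> strategies menu signals" if "b0 \<in> menu" "b1 \<in> menu" for b0 b1
    using that by (auto simp: strategies_def)
  have E: "(\<integral>w. g w \<partial>interval_measure F) \<le> expected_payoff g (?\<beta> (\<lambda>_. 0) (\<lambda>_. 0) 0) (?\<beta> (\<lambda>_. 0) (\<lambda>_. 0) 1) 0"
    by (simp add: expected_payoff_zero)
  have "?\<beta> (\<lambda>_. 0) (\<lambda>_. 0) \<in> strategies menu signals"
    by (intro \<beta>) auto
  note compare = willingness_to_pay_compare[where W="\<lambda>\<beta> \<mu>. expected_payoff g (\<beta> 0) (\<beta> 1) \<mu>",
      OF finite_strategies ext_integral_outcome_cdf_payoff[OF assms]
        ext_integral_eq_integral[OF integrable_utility[OF assms]] _ this E]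
  have slopes: "slopes_within \<gamma> L (\<lambda>\<mu>. - expected_payoff g (\<beta> 0) (\<beta> 1) \<mu>)"
    if "\<beta> \<in> strategies menu signals" for \<beta>
    using strategies_menu[OF that] by (rule slopes_within_expected_payoff[OF assms])
  show "willingness_to_pay F f menu signals signal g < a"
    if less: "\<And>b0 b1. b0 \<in> menu \<Longrightarrow> b1 \<in> menu \<Longrightarrow> expected_payoff g b0 b1 a < (\<integral>w. g w \<partial>interval_measure F)"
  proof (rule compare(1))
    show "expected_payoff g (\<beta> 0) (\<beta> 1) a < (\<integral>w. g w \<partial>interval_measure F)"
      if "\<beta> \<in> strategies menu signals" for \<beta>
      using strategies_menu[OF that] by (rule less)
  qed (assumption | rule slopes)+
  show "a < willingness_to_pay F f menu signals signal g"
    if "b0 \<in> menu" "b1 \<in> menu" "(\<integral>w. g w \<partial>interval_measure F) < expected_payoff g b0 b1 a"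
  proof (rule compare(2))
    show "?\<beta> b0 b1 \<in> strategies menu signals"
      using that(1,2) by (rule \<beta>)
    show "(\<integral>w. g w \<partial>interval_measure F) < expected_payoff g (?\<beta> b0 b1 0) (?\<beta> b0 b1 1) a"
      using that(3) by simp
  qed (assumption | rule slopes)+
qed

text \<open>Below \<open>ws\<close> the utility is affine, so the loss \<open>A\<close> outweighs the gain \<open>2\<close> in expectation
  no matter how the utility behaves above \<open>ws\<close>.\<close>

context
  fixes \<gamma> L :: real and g :: "real \<Rightarrow> real"
  assumes slopes: "slopes_within \<gamma> L g"
    and affine: "\<And>x y. x \<le> y \<Longrightarrow> y \<le> ws \<Longrightarrow> g y - g x = L * (y - x)"
begin

text \<open>Above \<open>ws\<close> the asset adds at most \<open>2 * L\<close>. Below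
  \<open>ws\<close> it costs exactly \<open>L * A\<close> by affinity, which is \<open>2 * L\<close>
  minus the penalty \<open>L * (A + 2)\<close>. The price costs at least
  \<open>\<gamma> * \<mu>\<close> in either case.\<close>

lemma asset_utility_le:
  assumes "0 \<le> \<mu>"
  shows "g (w + asset w - \<mu>) \<le> g w + 2 * L - L * (A + 2) * indicator {..<ws} w - \<gamma> * \<mu>"
proof (cases "w < ws")
  case True
  have "\<gamma> * \<mu> \<le> L * \<mu>"
    using assms slopes_withinD(2)[OF slopes] by (rule mult_right_mono[rotated])
  then show ?thesis
    using True affine[of "w - A - \<mu>" w] A(1) assms by (simp add: asset_def algebra_simps)
next
  case False
  then have "asset w \<le> 2"
    by (simp add: asset_def)
  then have "g (w + asset w - \<mu>) \<le> g (w + 2 - \<mu>)"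
    using slopes_within_strict_mono[OF slopes] by (simp add: strict_mono_less_eq)
  then show ?thesis
    using False slopes_withinD(3)[OF slopes, of "w + 2 - \<mu>" "w + 2"] slopes_withinD(4)[OF slopes, of w "w + 2"] assms
    by (simp add: algebra_simps)
qed

lemma integral_penalty_le:
  "(\<integral>w. g w + 2 * L - L * (A + 2) * indicator {..<ws} w - c \<partial>interval_measure F)
    \<le> (\<integral>w. g w \<partial>interval_measure F) - c"
proof -
  let ?m = "measure (interval_measure F) {..<ws}"
  have L: "0 \<le> L"
    using slopes_withinD(1,2)[OF slopes] by simp
  have "2 \<le> (A + 2) * ?m"
    using A(2) by (simp add: algebra_simps add_increasing2)
  then have "L * 2 \<le> L * ((A + 2) * ?m)"
    using L by (rule mult_left_mono)
  moreover have "(\<integral>w. g w + 2 * L - L * (A + 2) * indicator {..<ws} w - c \<partial>interval_measure F) =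
    (\<integral>w. g w \<partial>interval_measure F) + 2 * L - L * (A + 2) * ?m - c"
    using integrable_utility[OF slopes] integrable_indicator_state[of "{..<ws}"]
    by (simp add: prob_UNIV)
  ultimately show ?thesis
    by simp
qed

lemma integrable_penalty:
  "F_integrable F (\<lambda>w. g w + 2 * L - L * (A + 2) * indicator {..<ws} w - c)"
  using integrable_utility[OF slopes] integrable_indicator_state[of "{..<ws}"] by simp

lemma zero_investment_optimal: "ZAZI F menu g"
proof -
  have int: "F_integrable F (\<lambda>w. g (w + asset w))"
    by (intro slopes_within_integrable[OF slopes P.finite_measure_axioms] Bochner_Integration.integrable_add
        integrable_state integrable_asset)
  have "(\<integral>w. g (w + asset w) \<partial>interval_measure F) \<le>
    (\<integral>w. g w + 2 * L - L * (A + 2) * indicator {..<ws} w - 0 \<partial>interval_measure F)"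
    using asset_utility_le[of 0] by (intro integral_mono int integrable_penalty) simp
  also have "\<dots> \<le> (\<integral>w. g w \<partial>interval_measure F)"
    using integral_penalty_le[of 0] by simp
  finally show ?thesis
    unfolding ZAZI_def is_arg_max_def
    by (auto simp: ext_integral_eq_integral[OF int] ext_integral_eq_integral[OF integrable_utility[OF slopes]])
qed

text \<open>Never investing only wastes the price, and investing after the low signal incurs the
  full penalty below \<open>ws\<close>. This leaves investing after the high signal only, which the
  second assumption handles.\<close>

lemma willingness_to_pay_less:
  assumes "0 < \<mu>" and "expected_payoff g (\<lambda>_. 0) asset \<mu> < (\<integral>w. g w \<partial>interval_measure F)"
  shows "willingness_to_pay F f menu signals signal g < \<mu>"
proof (rule willingness_to_pay_cases(1)[OF slopes])
  fix b0 b1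
  assume menu: "b0 \<in> menu" "b1 \<in> menu"
  have \<gamma>: "0 < \<gamma> * \<mu>"
    using assms(1) slopes_withinD(1)[OF slopes] by simp
  have L: "0 \<le> L"
    using slopes_withinD(1,2)[OF slopes] by simp
  have zero: "g (w - \<mu>) \<le> g w - \<gamma> * \<mu>" for w
    using slopes_withinD(3)[OF slopes, of "w - \<mu>" w] assms(1) by simp
  consider "b0 = (\<lambda>_. 0)" "b1 = (\<lambda>_. 0)" | "b0 = (\<lambda>_. 0)" "b1 = asset" | "b0 = asset"
    using menu by auto
  then show "expected_payoff g b0 b1 \<mu> < (\<integral>w. g w \<partial>interval_measure F)"
  proof cases
    case 1
    have "expected_payoff g b0 b1 \<mu> \<le> (\<integral>w. g w - \<gamma> * \<mu> \<partial>interval_measure F)"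
      unfolding expected_payoff_def using integrable_utility[OF slopes]
      by (intro integral_mono integrable_payoff[OF slopes] menu payoff_le) (auto simp: 1 zero)
    then show ?thesis
      using \<gamma> integrable_utility[OF slopes] by (simp add: prob_UNIV)
  next
    case 2
    then show ?thesis
      using assms(2) by simp
  next
    case 3
    have "payoff b0 b1 \<mu> g w \<le> g w + 2 * L - L * (A + 2) * indicator {..<ws} w - \<gamma> * \<mu>" for w
    proof (cases "w < ws")
      case True
      \<comment> \<open>Below \<open>ws\<close> the signal is surely 0, so \<open>b1\<close> has no
        influence here.\<close>
      then have "payoff b0 b1 \<mu> g w = g (w + asset w - \<mu>)"
        by (simp add: payoff_def pmf_signal 3)
      then show ?thesis
        using asset_utility_le[of \<mu> w] assms(1) by simp
    next
      case False
      \<comment> \<open>From \<open>ws\<close> on the indicator vanishes, so the bound holds for the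
        zero asset as well and hence for any choice of \<open>b1\<close>.\<close>
      have "g (w + b w - \<mu>) \<le> g w + 2 * L - L * (A + 2) * indicator {..<ws} w - \<gamma> * \<mu>" if "b \<in> menu" for b
        using that zero[of w] asset_utility_le[of \<mu> w] assms(1) False L by auto
      then show ?thesis
        using menu by (intro payoff_le) blast+
    qed
    then have "expected_payoff g b0 b1 \<mu> \<le>
      (\<integral>w. g w + 2 * L - L * (A + 2) * indicator {..<ws} w - \<gamma> * \<mu> \<partial>interval_measure F)"
      unfolding expected_payoff_def by (intro integral_mono integrable_payoff[OF slopes] menu integrable_penalty)
    then show ?thesis
      using integral_penalty_le[of "\<gamma> * \<mu>"] \<gamma> by simp
  qed
qed

end

end

subsection \<open>Kinked utilities\<close>

lemma concave_on_mult_min: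
  assumes "0 \<le> a"
  shows "concave_on UNIV (\<lambda>x :: real. a * min x k)"
  unfolding concave_on_iff
proof (intro conjI ballI allI impI)
  fix s t x y :: real
  assume st: "0 \<le> s" "0 \<le> t" "s + t = 1"
  have "s * min x k + t * min y k \<le> s * x + t * y"
    using st by (intro add_mono mult_left_mono) auto
  moreover have "s * min x k + t * min y k \<le> s * k + t * k"
    using st by (intro add_mono mult_left_mono) auto
  moreover have "s * k + t * k = k"
    using st by (simp add: distrib_right[symmetric])
  ultimately have "s * min x k + t * min y k \<le> min (s * x + t * y) k"
    by simp
  then have "a * (s * min x k + t * min y k) \<le> a * min (s * x + t * y) k"
    using assms by (rule mult_left_mono)
  then show "s * (a * min x k) + t * (a * min y k) \<le> a * min (s *\<^sub>R x + t *\<^sub>R y) k"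
    by (simp add: algebra_simps)
qed simp

lemma slopes_within_add_min:
  assumes "slopes_within \<gamma> L g"
  shows "slopes_within \<gamma> (1 + L) (\<lambda>m. min m k + g m)"
  unfolding slopes_within_def
proof (intro conjI allI impI)
  show "0 < \<gamma>"
    using slopes_withinD(1)[OF assms] .
  fix x y :: real
  assume "x \<le> y"
  then have "0 \<le> min y k - min x k" "min y k - min x k \<le> y - x"
    by auto
  then show "\<gamma> * (y - x) \<le> min y k + g y - (min x k + g x)"
    and "min y k + g y - (min x k + g x) \<le> (1 + L) * (y - x)"
    using slopes_withinD(3,4)[OF assms \<open>x \<le> y\<close>] by (auto simp: distrib_right)
qed

lemma slopes_within_mult:
  assumes "slopes_within \<gamma> L g" "0 < c"
  shows "slopes_within (c * \<gamma>) (c * L) (\<lambda>m. c * g m)"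
  unfolding slopes_within_def
proof (intro conjI allI impI)
  show "0 < c * \<gamma>"
    using slopes_withinD(1)[OF assms(1)] assms(2) by simp
  fix x y :: real
  assume "x \<le> y"
  from slopes_withinD(3,4)[OF assms(1) this]
  show "c * \<gamma> * (y - x) \<le> c * g y - c * g x" "c * g y - c * g x \<le> c * L * (y - x)"
    using assms(2) mult_left_mono[of "\<gamma> * (y - x)" "g y - g x" c] mult_left_mono[of "g y - g x" "L * (y - x)" c]
    by (auto simp: algebra_simps)
qed

lemma slopes_within_ident: "slopes_within 1 1 (\<lambda>m. m)"
  by (simp add: slopes_within_def)

text \<open>The small linear term makes \<open>min m K\<close> strictly increasing.\<close>

definition kinked_high :: "real \<Rightarrow> real \<Rightarrow> real \<Rightarrow> real" where
  "kinked_high \<epsilon> K m = min m K + \<epsilon> * m"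

text \<open>The perturbation is a multiple of \<open>kinked_high\<close>, rather than linear, so
  that the sum is a concave transform of \<open>kinked_high\<close>.\<close>

definition kinked_low :: "real \<Rightarrow> real \<Rightarrow> real \<Rightarrow> real \<Rightarrow> real \<Rightarrow> real" where
  "kinked_low \<delta> \<epsilon> k K m = min m k + \<delta> * kinked_high \<epsilon> K m"

lemma slopes_within_kinked_high:
  assumes "0 < \<epsilon>"
  shows "slopes_within \<epsilon> (1 + \<epsilon>) (kinked_high \<epsilon> K)"
  using slopes_within_add_min[OF slopes_within_mult[OF slopes_within_ident assms]]
  by (simp add: kinked_high_def[abs_def])

lemma slopes_within_kinked_low:
  assumes "0 < \<epsilon>" "0 < \<delta>"
  shows "slopes_within (\<delta> * \<epsilon>) (1 + \<delta> * (1 + \<epsilon>)) (kinked_low \<delta> \<epsilon> k K)"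
  using slopes_within_add_min[OF slopes_within_mult[OF slopes_within_kinked_high[OF assms(1)] assms(2)]]
  by (simp add: kinked_low_def[abs_def])

lemma concave_on_kinked:
  assumes "0 < \<epsilon>" "0 < \<delta>"
  shows "concave_on UNIV (kinked_high \<epsilon> K)" "concave_on UNIV (kinked_low \<delta> \<epsilon> k K)"
proof -
  show *: "concave_on UNIV (kinked_high \<epsilon> K)"
    unfolding kinked_high_def[abs_def] using assms concave_on_mult_min[of 1 K]
    by (intro concave_on_add concave_on_cmul) (auto simp: concave_on_ident)
  show "concave_on UNIV (kinked_low \<delta> \<epsilon> k K)"
    unfolding kinked_low_def[abs_def] using assms concave_on_mult_min[of 1 k] *
    by (intro concave_on_add concave_on_cmul) auto
qed

lemma kinked_low_more_risk_averse:
  assumes "0 < \<epsilon>" "0 < \<delta>" "k \<le> K"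
  shows "more_risk_averse (kinked_low \<delta> \<epsilon> k K) (kinked_high \<epsilon> K)"
  unfolding more_risk_averse_def
proof (intro exI conjI)
  \<comment> \<open>Up to \<open>k \<le> K\<close> the inner utility is multiplication by
    \<open>1 + \<epsilon>\<close>. Truncating it at its value in \<open>k\<close> and rescaling
    therefore recovers \<open>min m k\<close>.\<close>
  let ?\<phi> = "\<lambda>y. 1 / (1 + \<epsilon>) * min y ((1 + \<epsilon>) * k) + \<delta> * y"
  show "strict_mono ?\<phi>"
  proof (rule strict_monoI)
    fix x y :: real
    assume "x < y"
    then show "?\<phi> x < ?\<phi> y"
      using assms by (intro add_le_less_mono mult_left_mono mult_strict_left_mono) auto
  qed
  show "concave_on UNIV ?\<phi>"
    using assms by (intro concave_on_add concave_on_mult_min concave_on_cmul) (auto simp: concave_on_ident)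
  have "1 / (1 + \<epsilon>) * min (kinked_high \<epsilon> K m) ((1 + \<epsilon>) * k) = min m k" for m
  proof (cases "m \<le> k")
    case True
    then have "kinked_high \<epsilon> K m = (1 + \<epsilon>) * m"
      using assms by (simp add: kinked_high_def distrib_right)
    moreover have "(1 + \<epsilon>) * m \<le> (1 + \<epsilon>) * k"
      using assms True by (intro mult_left_mono) auto
    ultimately have "min (kinked_high \<epsilon> K m) ((1 + \<epsilon>) * k) = (1 + \<epsilon>) * m"
      by simp
    then show ?thesis
      using assms True by simp
  next
    case False
    then have "\<epsilon> * k \<le> \<epsilon> * m" "k \<le> min m K"
      using assms by simp_all
    then have "(1 + \<epsilon>) * k \<le> kinked_high \<epsilon> K m"
      unfolding kinked_high_def distrib_right by linarith
    then show ?thesis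
      using assms False by (simp add: min_absorb2)
  qed
  then show "kinked_low \<delta> \<epsilon> k K = ?\<phi> \<circ> kinked_high \<epsilon> K"
    by (simp add: fun_eq_iff kinked_low_def)
qed

section \<open>Effect of information bought at price 1 under kinked utilities\<close>

context step_environment
begin

text \<open>After the low signal wealth falls by the price 1; after the high signal, possible only
  above \<open>ws\<close>, the payoff 2 turns this into a net rise of 1.\<close>

lemma payoff_min:
  "payoff (\<lambda>_. 0) asset 1 (\<lambda>m. min m k) w =
    min w k - ramp (k + 1 - w) + (if ws < w then q * (ramp (k + 1 - w) + ramp (k - w)) else 0)"
proof -
  have eq: "min (w - 1) k = min w k - ramp (k + 1 - w)" "min (w + 1) k = min w k + ramp (k - w)"
    by (auto simp: ramp_def)
  have "payoff (\<lambda>_. 0) asset 1 (\<lambda>m. min m k) w =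
    (if ws < w then (1 - q) * min (w - 1) k + q * min (w + 1) k else min (w - 1) k)"
    by (simp add: payoff_def pmf_signal asset_def add.commute[of w 1])
  then show ?thesis
    using eq by (simp only:) (simp add: algebra_simps)
qed

text \<open>The mean utility change in \<open>payoff_min\<close> with the restriction
  \<open>ws < w\<close> dropped.\<close>

definition gain :: "real \<Rightarrow> real" where
  "gain k = q * (ramp_mean F (k + 1) + ramp_mean F k) - ramp_mean F (k + 1)"

lemma integrable_gain:
  "F_integrable F (\<lambda>w. q * (ramp (k + 1 - w) + ramp (k - w)) - ramp (k + 1 - w))"
  using integrable_ramp[OF cdf] by simp

lemma integral_gain:
  "(\<integral>w. q * (ramp (k + 1 - w) + ramp (k - w)) - ramp (k + 1 - w) \<partial>interval_measure F) = gain k"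
  using integrable_ramp[OF cdf] by (simp add: gain_def ramp_mean_def)

text \<open>Dropping the restriction \<open>ws < w\<close> adds only nonnegative terms, and expected
  wealth in a given state rises by at most 1, which bounds the linear part by \<epsilon>.\<close>

lemma expected_payoff_kinked_high_le:
  assumes "0 < \<epsilon>"
  shows "expected_payoff (kinked_high \<epsilon> K) (\<lambda>_. 0) asset 1 \<le>
    (\<integral>w. kinked_high \<epsilon> K w \<partial>interval_measure F) + gain K + \<epsilon>"
proof -
  note slopes = slopes_within_kinked_high[OF assms, of K]
  have le: "payoff (\<lambda>_. 0) asset 1 (kinked_high \<epsilon> K) w \<le>
    kinked_high \<epsilon> K w + (q * (ramp (K + 1 - w) + ramp (K - w)) - ramp (K + 1 - w)) + \<epsilon>" for w
  proof -
    have "payoff (\<lambda>_. 0) asset 1 (kinked_high \<epsilon> K) w =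
      payoff (\<lambda>_. 0) asset 1 (\<lambda>m. min m K) w + \<epsilon> * payoff (\<lambda>_. 0) asset 1 (\<lambda>m. m) w"
      by (simp add: payoff_def kinked_high_def algebra_simps)
    moreover have "payoff (\<lambda>_. 0) asset 1 (\<lambda>m. m) w \<le> w + 1"
      using A(1) q by (cases "ws < w") (auto simp: payoff_def pmf_signal asset_def algebra_simps)
    then have "\<epsilon> * payoff (\<lambda>_. 0) asset 1 (\<lambda>m. m) w \<le> \<epsilon> * (w + 1)"
      using assms by (intro mult_left_mono) auto
    moreover have "0 \<le> q * (ramp (K + 1 - w) + ramp (K - w))"
      using q by (intro mult_nonneg_nonneg add_nonneg_nonneg ramp_bounds) auto
    ultimately show ?thesis
      by (auto simp: payoff_min kinked_high_def distrib_left)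
  qed
  have "expected_payoff (kinked_high \<epsilon> K) (\<lambda>_. 0) asset 1 \<le>
    (\<integral>w. kinked_high \<epsilon> K w + (q * (ramp (K + 1 - w) + ramp (K - w)) - ramp (K + 1 - w)) + \<epsilon>
      \<partial>interval_measure F)"
    unfolding expected_payoff_def
    using integrable_gain[of K] integrable_utility[OF slopes] integrable_payoff[OF slopes] le
    by (intro integral_mono) auto
  also have "\<dots> = (\<integral>w. kinked_high \<epsilon> K w \<partial>interval_measure F) + gain K + \<epsilon>"
    unfolding integral_gain[symmetric]
    using integrable_gain[of K] integrable_utility[OF slopes] by (simp add: prob_UNIV)
  finally show ?thesis .
qed

text \<open>The terms missing when \<open>w \<le> ws\<close> are at most 2. Wealth never falls by
  more than 1, so the perturbation loses at most \<open>\<delta> * (1 + \<epsilon>)\<close>.\<close>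

lemma expected_payoff_kinked_low_ge:
  assumes "0 < \<epsilon>" "0 < \<delta>"
  shows "(\<integral>w. kinked_low \<delta> \<epsilon> k K w \<partial>interval_measure F) + gain k
      - 2 * measure (interval_measure F) {..ws} - \<delta> * (1 + \<epsilon>) \<le>
    expected_payoff (kinked_low \<delta> \<epsilon> k K) (\<lambda>_. 0) asset 1"
proof -
  note slopes = slopes_within_kinked_low[OF assms, of k K]
  note high = slopes_within_kinked_high[OF assms(1), of K]
  have ge: "kinked_low \<delta> \<epsilon> k K w + (q * (ramp (k + 1 - w) + ramp (k - w)) - ramp (k + 1 - w))
      - 2 * indicator {..ws} w - \<delta> * (1 + \<epsilon>) \<le> payoff (\<lambda>_. 0) asset 1 (kinked_low \<delta> \<epsilon> k K) w" for w
  proof -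
    have "payoff (\<lambda>_. 0) asset 1 (kinked_low \<delta> \<epsilon> k K) w =
      payoff (\<lambda>_. 0) asset 1 (\<lambda>m. min m k) w + \<delta> * payoff (\<lambda>_. 0) asset 1 (kinked_high \<epsilon> K) w"
      by (simp add: payoff_def kinked_low_def algebra_simps)
    moreover have "kinked_high \<epsilon> K w - (1 + \<epsilon>) \<le> payoff (\<lambda>_. 0) asset 1 (kinked_high \<epsilon> K) w"
    proof -
      have "kinked_high \<epsilon> K w - (1 + \<epsilon>) \<le> kinked_high \<epsilon> K (w - 1)"
        using slopes_withinD(4)[OF high, of "w - 1" w] by simp
      moreover have "kinked_high \<epsilon> K (w - 1) \<le> kinked_high \<epsilon> K (w + 1)"
        using slopes_within_strict_mono[OF high] by (simp add: strict_mono_less_eq)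
      then have "q * kinked_high \<epsilon> K (w - 1) \<le> q * kinked_high \<epsilon> K (w + 1)"
        using q by (intro mult_left_mono) auto
      ultimately show ?thesis
        by (auto simp: payoff_def pmf_signal asset_def algebra_simps)
    qed
    then have "\<delta> * (kinked_high \<epsilon> K w - (1 + \<epsilon>)) \<le> \<delta> * payoff (\<lambda>_. 0) asset 1 (kinked_high \<epsilon> K) w"
      using assms by (intro mult_left_mono) auto
    moreover have "q * (ramp (k + 1 - w) + ramp (k - w)) \<le> 1 * (1 + 1)"
      using q by (intro mult_mono add_mono add_nonneg_nonneg ramp_bounds) auto
    ultimately show ?thesis
      by (auto simp: payoff_min kinked_low_def right_diff_distrib)
  qed
  have "(\<integral>w. kinked_low \<delta> \<epsilon> k K w + (q * (ramp (k + 1 - w) + ramp (k - w)) - ramp (k + 1 - w))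
      - 2 * indicator {..ws} w - \<delta> * (1 + \<epsilon>) \<partial>interval_measure F) \<le>
    expected_payoff (kinked_low \<delta> \<epsilon> k K) (\<lambda>_. 0) asset 1"
    unfolding expected_payoff_def
    using integrable_gain[of k] integrable_utility[OF slopes] integrable_payoff[OF slopes]
      integrable_indicator_state[of "{..ws}"] ge
    by (intro integral_mono) auto
  also have "(\<integral>w. kinked_low \<delta> \<epsilon> k K w + (q * (ramp (k + 1 - w) + ramp (k - w)) - ramp (k + 1 - w))
      - 2 * indicator {..ws} w - \<delta> * (1 + \<epsilon>) \<partial>interval_measure F) =
    (\<integral>w. kinked_low \<delta> \<epsilon> k K w \<partial>interval_measure F) + gain k
      - 2 * measure (interval_measure F) {..ws} - \<delta> * (1 + \<epsilon>)"
    unfolding integral_gain[symmetric]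
    using integrable_gain[of k] integrable_utility[OF slopes] integrable_indicator_state[of "{..ws}"]
    by (simp add: prob_UNIV)
  finally show ?thesis .
qed

end

section \<open>Choice of the parameters and comparison of the two agents\<close>

theorem proposition2:
  fixes F f :: "real \<Rightarrow> real" and \<omega> :: real
  assumes "is_cdf F"
    and "F_integrable F (\<lambda>w. \<bar>w\<bar>)"
    and "has_density F f"
    and "f C1_differentiable_on {..<\<omega>}"
    and "\<forall>w<\<omega>. 0 < f w"
    and "strictly_convex_on {..<\<omega>} (\<lambda>w. ln (f w))"
  shows "\<exists>B b X h u v.
      B = {(\<lambda>_. 0), b} \<and> is_investment_menu F B \<and>
      is_experiment F X h \<and> card X = 2 \<and> MLR_ordered X h \<and>
      u \<in> utilities F \<and> v \<in> utilities F \<and>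
      strict_mono u \<and> (\<exists>L. L-lipschitz_on UNIV u) \<and> concave_on UNIV u \<and>
      strict_mono v \<and> (\<exists>L. L-lipschitz_on UNIV v) \<and> concave_on UNIV v \<and>
      ZAZI F B u \<and> ZAZI F B v \<and>
      more_risk_averse u v \<and>
      willingness_to_pay F f B X h u > willingness_to_pay F f B X h v"
proof -
  interpret P: real_distribution "interval_measure F"
    using assms(1) by (rule real_distribution_interval_measure_is_cdf)
  have pos: "0 < f w" if "w < k" "k \<le> \<omega>" for w k
    using assms(5) that by simp
  have state: "F_integrable F (\<lambda>w. w)"
    by (rule integrable_abs_cancel[OF assms(2)]) simp
  define H0 H1 H2 where "H0 = ramp_mean F (\<omega> - 2)" and "H1 = ramp_mean F (\<omega> - 1)" and "H2 = ramp_mean F \<omega>"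
  have H: "0 < H0" "0 < H1" "0 < H2"
    unfolding H0_def H1_def H2_def using pos by (auto intro!: ramp_mean_pos[OF assms(1,3)])
  \<comment> \<open>Centred at \<open>\<omega> - 1\<close>, so that the densities involved are
    evaluated only below \<omega>.\<close>
  have "H1 ^ 2 < H0 * H2"
    using ramp_mean_strictly_log_convex[OF assms(1,3), of "\<omega> - 1"] assms(5,6)
    by (simp add: H0_def H1_def H2_def)
  \<comment> \<open>These are the values of \<open>q\<close> at which the gain vanishes for the
    kinks \<open>\<omega> - 2\<close> and \<open>\<omega> - 1\<close>; between them it is positive
    at the lower kink and negative at the higher one.\<close>
  then have "H1 / (H0 + H1) < H2 / (H1 + H2)"
    using H by (simp add: field_simps power2_eq_square)
  then obtain q where q: "H1 / (H0 + H1) < q" "q < H2 / (H1 + H2)"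
    using dense by blast
  have q01: "0 < q" "q < 1"
  proof -
    have "0 < H1 / (H0 + H1)" "H2 / (H1 + H2) < 1"
      using H by simp_all
    then show "0 < q" "q < 1"
      using q by linarith+
  qed
  define gain_low loss_high where "gain_low = q * (H1 + H0) - H1" and "loss_high = H2 - q * (H2 + H1)"
  have gains: "0 < gain_low" "0 < loss_high"
    using q H by (simp_all add: gain_low_def loss_high_def field_simps)
  define \<epsilon> where "\<epsilon> = loss_high / 2"
  have \<epsilon>: "0 < \<epsilon>" "\<epsilon> < loss_high"
    using gains by (auto simp: \<epsilon>_def)
  \<comment> \<open>The perturbation uses a quarter of the gain; the mass below \<open>ws\<close>,
    counted twice, will use less than half, so the net effect stays positive.\<close>
  define \<delta> where "\<delta> = gain_low / (4 * (1 + \<epsilon>))"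
  have \<delta>: "0 < \<delta>" "\<delta> * (1 + \<epsilon>) = gain_low / 4"
    using gains \<epsilon> by (simp_all add: \<delta>_def divide_eq_eq)
  have "\<forall>\<^sub>F w in at_bot. cdf (interval_measure F) w < min 1 (gain_low / 4)"
    using P.cdf_lim_at_bot gains by (intro order_tendstoD(2)) auto
  then obtain N where N: "\<And>w. w \<le> N \<Longrightarrow> cdf (interval_measure F) w < min 1 (gain_low / 4)"
    by (auto simp: eventually_at_bot_linorder)
  \<comment> \<open>Besides having small mass below it, the threshold must not exceed either kink,
    so that both utilities are affine up to \<open>ws\<close>.\<close>
  define ws where "ws = min N (\<omega> - 2)"
  have small: "ws \<le> \<omega> - 2" "measure (interval_measure F) {..ws} < 1"
    "measure (interval_measure F) {..ws} < gain_low / 4"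
    using N[of ws] by (auto simp: ws_def cdf_def)
  define m where "m = measure (interval_measure F) {..<ws}"
  have m: "0 < m"
    unfolding m_def using pos small(1) by (intro measure_lessThan_pos[OF assms(1,3)]) auto
  \<comment> \<open>The loss \<open>2 / m\<close> makes the expected loss below \<open>ws\<close>
    exactly 2.\<close>
  interpret step_environment F f q "2 / m" ws
  proof
    show "is_cdf F" "has_density F f" by fact+
    show "2 \<le> 2 / m * measure (interval_measure F) {..<ws}"
      using m by (simp add: m_def)
  qed (use state q01 small m in auto)
  define u v where "u = kinked_low \<delta> \<epsilon> (\<omega> - 2) (\<omega> - 1)" and "v = kinked_high \<epsilon> (\<omega> - 1)"
  have u: "slopes_within (\<delta> * \<epsilon>) (1 + \<delta> * (1 + \<epsilon>)) u"
    unfolding u_def using \<epsilon>(1) \<delta>(1) by (rule slopes_within_kinked_low)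
  have v: "slopes_within \<epsilon> (1 + \<epsilon>) v"
    unfolding v_def using \<epsilon>(1) by (rule slopes_within_kinked_high)
  have v_affine: "v y - v x = (1 + \<epsilon>) * (y - x)" if "x \<le> y" "y \<le> ws" for x y
    using that small(1) by (simp add: v_def kinked_high_def min_absorb1 algebra_simps)
  have u_affine: "u y - u x = (1 + \<delta> * (1 + \<epsilon>)) * (y - x)" if "x \<le> y" "y \<le> ws" for x y
    using that small(1) by (simp add: u_def kinked_low_def kinked_high_def min_absorb1 algebra_simps)
  have "gain (\<omega> - 1) = - loss_high" "gain (\<omega> - 2) = gain_low"
    by (simp_all add: gain_def loss_high_def gain_low_def H0_def H1_def H2_def algebra_simps)
  then have "expected_payoff v (\<lambda>_. 0) asset 1 < (\<integral>w. v w \<partial>interval_measure F)"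
    and "(\<integral>w. u w \<partial>interval_measure F) < expected_payoff u (\<lambda>_. 0) asset 1"
    using expected_payoff_kinked_high_le[OF \<epsilon>(1), of "\<omega> - 1"] \<epsilon>(2)
      expected_payoff_kinked_low_ge[OF \<epsilon>(1) \<delta>(1), of "\<omega> - 2" "\<omega> - 1"] \<delta>(2) small(3) gains(1)
    unfolding u_def v_def by linarith+
  then have "willingness_to_pay F f menu signals signal v < 1"
    and "1 < willingness_to_pay F f menu signals signal u"
    using willingness_to_pay_less[OF v v_affine, of 1]
      willingness_to_pay_cases(2)[OF u, of "\<lambda>_. 0" asset 1] by auto
  then have "willingness_to_pay F f menu signals signal v < willingness_to_pay F f menu signals signal u"
    by linarith
  moreover have "more_risk_averse u v"
    unfolding u_def v_def using \<epsilon>(1) \<delta>(1) by (intro kinked_low_more_risk_averse) auto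
  moreover have "ZAZI F menu u" "ZAZI F menu v"
    using zero_investment_optimal[OF u u_affine] zero_investment_optimal[OF v v_affine] by blast+
  moreover have "concave_on UNIV u" "concave_on UNIV v"
    unfolding u_def v_def using concave_on_kinked[OF \<epsilon>(1) \<delta>(1)] by blast+
  moreover have "strict_mono u" "strict_mono v" "u \<in> utilities F" "v \<in> utilities F"
    using slopes_within_strict_mono slopes_within_utilities[OF _ assms(1) state] u v by blast+
  moreover have "\<exists>L. L-lipschitz_on UNIV u" "\<exists>L. L-lipschitz_on UNIV v"
    using slopes_within_lipschitz u v by blast+
  moreover have "card signals = 2"
    by simp
  ultimately show ?thesis
    using investment_menu signal_experiment MLR
    by (intro exI[of _ menu] exI[of _ asset] exI[of _ signals] exI[of _ signal] exI[of _ u] exI[of _ v] conjI refl)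
qed

end
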